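(* Let $\Gamma$ be a disconnected graph. Then $A_{\Gamma}$ has the $R_\infty$-property.
   Context: A graph is a finite simple non-empty graph $\Gamma(V,E)$. The right-angled Artin group associated to $\Gamma$ is $A_\Gamma=\langle V \mid [v,w],\ vw\in E\rangle$. For a group $G$ and $\varphi\in\operatorname{Aut}(G)$, elements $x,y\in G$ are $\varphi$-conjugate if $x=gy\varphi(g)^{-1}$ for some $g\in G$; the Reidemeister number $R(\varphi)\in\{1,2,\dots\}\cup\{\infty\}$ is the number of $\varphi$-conjugacy classes ($\infty$ if there are infinitely many). $G$ has the $R_\infty$-property if $R(\varphi)=\infty$ for all $\varphi\in\operatorname{Aut}(G)$. *)

theory Defs
  imports
    "HOL-Algebra.Group"
    "HOL-Library.Extended_Nat"
    "Graph_Theory.Graph_Theory"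
begin

section \<open>Group presentations\<close>

text \<open>
  A letter \<open>(s, True)\<close> stands for the generator \<open>s\<close>, and \<open>(s, False)\<close> for its formal inverse.
\<close>

type_synonym 'a letter = "'a \<times> bool"
type_synonym 'a word = "'a letter list"

definition inv_letter :: "'a letter \<Rightarrow> 'a letter" where
  "inv_letter x = (fst x, \<not> snd x)"

definition words :: "'a set \<Rightarrow> 'a word set" where
  "words S = lists (S \<times> UNIV)"

inductive_set word_rel :: "'a set \<Rightarrow> 'a word set \<Rightarrow> ('a word \<times> 'a word) set"
  for S :: "'a set" and R :: "'a word set" where
  refl: "w \<in> words S \<Longrightarrow> (w, w) \<in> word_rel S R"
| sym: "(v, w) \<in> word_rel S R \<Longrightarrow> (w, v) \<in> word_rel S R"
| trans: "(u, v) \<in> word_rel S R \<Longrightarrow> (v, w) \<in> word_rel S R \<Longrightarrow> (u, w) \<in> word_rel S R"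
| cancel: "u \<in> words S \<Longrightarrow> v \<in> words S \<Longrightarrow> x \<in> S \<times> UNIV \<Longrightarrow>
    (u @ [x, inv_letter x] @ v, u @ v) \<in> word_rel S R"
| relator: "u \<in> words S \<Longrightarrow> v \<in> words S \<Longrightarrow> r \<in> R \<Longrightarrow> r \<in> words S \<Longrightarrow>
    (u @ r @ v, u @ v) \<in> word_rel S R"

text \<open>
  The group \<open>\<langle>S | R\<rangle>\<close>: classes of words modulo free cancellation and deletion or insertion of
  relators, i.e. the free group on \<open>S\<close> modulo the normal closure of \<open>R\<close>, with multiplication
  induced by concatenation.
\<close>

definition presented_group :: "'a set \<Rightarrow> 'a word set \<Rightarrow> 'a word set monoid" where
  "presented_group S R =
    \<lparr>carrier = words S // word_rel S R,
     monoid.mult = (\<lambda>A B. \<Union>u\<in>A. \<Union>v\<in>B. word_rel S R `` {u @ v}),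
     one = word_rel S R `` {[]}\<rparr>"

lemma words_append [simp]: "u @ v \<in> words S \<longleftrightarrow> u \<in> words S \<and> v \<in> words S"
  by (auto simp: words_def)

lemma words_Nil [simp]: "[] \<in> words S"
  by (simp add: words_def)

lemma words_Cons [simp]: "x # v \<in> words S \<longleftrightarrow> x \<in> S \<times> UNIV \<and> v \<in> words S"
  by (auto simp: words_def)

lemma word_rel_words: "(u, v) \<in> word_rel S R \<Longrightarrow> u \<in> words S \<and> v \<in> words S"
  by (induction rule: word_rel.induct) (auto simp: inv_letter_def)

lemma equiv_word_rel: "equiv (words S) (word_rel S R)"
  by (rule equivI)
    (auto intro!: refl_onI symI transI intro: word_rel.intros dest: word_rel_words)

lemma word_rel_context:
  "(u, v) \<in> word_rel S R \<Longrightarrow> a \<in> words S \<Longrightarrow> b \<in> words S \<Longrightarrow>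
    (a @ u @ b, a @ v @ b) \<in> word_rel S R"
proof (induction rule: word_rel.induct)
  case (cancel u v x)
  then show ?case using word_rel.cancel[of "a @ u" S "v @ b" x R] by simp
next
  case (relator u v r)
  then show ?case using word_rel.relator[of "a @ u" S "v @ b" r R] by simp
qed (auto intro: word_rel.intros)

lemma word_rel_append:
  assumes "(u, u') \<in> word_rel S R" "(v, v') \<in> word_rel S R"
  shows "(u @ v, u' @ v') \<in> word_rel S R"
proof (rule word_rel.trans)
  show "(u @ v, u' @ v) \<in> word_rel S R"
    using word_rel_context[OF assms(1), of "[]" v] word_rel_words[OF assms(2)] by simp
  show "(u' @ v, u' @ v') \<in> word_rel S R"
    using word_rel_context[OF assms(2), of u' "[]"] word_rel_words[OF assms(1)] by simp
qed

lemma presented_group_mult: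
  assumes "u \<in> words S" "v \<in> words S"
  shows "(word_rel S R `` {u}) \<otimes>\<^bsub>presented_group S R\<^esub> (word_rel S R `` {v})
    = word_rel S R `` {u @ v}"
proof -
  have "congruent2 (word_rel S R) (word_rel S R) (\<lambda>u v. word_rel S R `` {u @ v})"
    by (rule congruent2I')
      (metis equiv_class_eq[OF equiv_word_rel] word_rel_append)
  from UN_equiv_class2[OF equiv_word_rel equiv_word_rel this assms]
  show ?thesis by (simp add: presented_group_def)
qed

lemma words_inverse: "w \<in> words S \<Longrightarrow> rev (map inv_letter w) \<in> words S"
  by (induction w) (auto simp: inv_letter_def)

lemma word_rel_inverse:
  "w \<in> words S \<Longrightarrow> (rev (map inv_letter w) @ w, []) \<in> word_rel S R"
proof (induction w)
  case Nil
  then show ?case by (simp add: word_rel.refl)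
next
  case (Cons x w)
  have w: "rev (map inv_letter w) \<in> words S" "w \<in> words S" "inv_letter x \<in> S \<times> UNIV"
    using Cons.prems words_inverse[of w S] by (auto simp: inv_letter_def)
  have "inv_letter (inv_letter x) = x" by (simp add: inv_letter_def)
  then show ?case
    using word_rel.cancel[OF w, of R] Cons.IH w by (auto intro: word_rel.trans)
qed

lemma group_presented_group: "group (presented_group S R)"
proof (rule groupI)
  let ?G = "presented_group S R" and ?c = "\<lambda>w. word_rel S R `` {w}"
  have car: "A \<in> carrier ?G \<longleftrightarrow> (\<exists>w\<in>words S. A = ?c w)" for A
    by (auto simp: presented_group_def quotient_def)
  have one: "\<one>\<^bsub>?G\<^esub> = ?c []" by (simp add: presented_group_def)
  show "\<one>\<^bsub>?G\<^esub> \<in> carrier ?G" unfolding car one by (rule bexI[of _ "[]"]) auto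
  show "\<one>\<^bsub>?G\<^esub> \<otimes>\<^bsub>?G\<^esub> A = A" if "A \<in> carrier ?G" for A
    using that unfolding car one by (auto simp: presented_group_mult simp del: Image_singleton_iff)
  show "A \<otimes>\<^bsub>?G\<^esub> B \<in> carrier ?G" if "A \<in> carrier ?G" "B \<in> carrier ?G" for A B
    using that unfolding car by (metis presented_group_mult words_append)
  show "A \<otimes>\<^bsub>?G\<^esub> B \<otimes>\<^bsub>?G\<^esub> C = A \<otimes>\<^bsub>?G\<^esub> (B \<otimes>\<^bsub>?G\<^esub> C)"
    if ABC: "A \<in> carrier ?G" "B \<in> carrier ?G" "C \<in> carrier ?G" for A B C
  proof -
    obtain u v w where "u \<in> words S" "v \<in> words S" "w \<in> words S"
      and "A = ?c u" "B = ?c v" "C = ?c w" using ABC unfolding car by blast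
    then show ?thesis by (simp add: presented_group_mult)
  qed
  show "\<exists>B\<in>carrier ?G. B \<otimes>\<^bsub>?G\<^esub> A = \<one>\<^bsub>?G\<^esub>" if A: "A \<in> carrier ?G" for A
  proof -
    obtain w where w: "w \<in> words S" "A = ?c w" using A unfolding car by blast
    let ?v = "rev (map inv_letter w)"
    have v: "?v \<in> words S" using w by (simp add: words_inverse)
    have "?c ?v \<otimes>\<^bsub>?G\<^esub> A = \<one>\<^bsub>?G\<^esub>"
      using w v equiv_class_eq[OF equiv_word_rel word_rel_inverse[OF w(1)]]
      by (simp add: presented_group_mult one)
    then show ?thesis using v car by blast
  qed
qed

section \<open>Right-angled Artin groups\<close>

definition commutator_word :: "'a \<Rightarrow> 'a \<Rightarrow> 'a word" where
  "commutator_word v w = [(v, True), (w, True), (v, False), (w, False)]"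

text \<open>
  A simple graph is a \<^locale>\<open>pair_graph\<close>: the edge \<open>vw\<close> is the pair of arcs \<open>(v, w)\<close>, \<open>(w, v)\<close>.
\<close>

definition raag :: "'a pair_pre_digraph \<Rightarrow> 'a word set monoid" where
  "raag \<Gamma> = presented_group (pverts \<Gamma>) {commutator_word v w | v w. (v, w) \<in> parcs \<Gamma>}"

lemma group_raag: "group (raag \<Gamma>)"
  by (simp add: raag_def group_presented_group)

section \<open>Twisted conjugacy\<close>

text \<open>
  Automorphisms of \<open>G\<close> are the elements of \<open>iso G G\<close>; their values outside \<open>carrier G\<close> are
  unconstrained and play no role below.
\<close>

definition twisted_conj :: "('g, 'm) monoid_scheme \<Rightarrow> ('g \<Rightarrow> 'g) \<Rightarrow> ('g \<times> 'g) set" where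
  "twisted_conj G \<phi> = {(x, y). x \<in> carrier G \<and> y \<in> carrier G \<and>
     (\<exists>g\<in>carrier G. x = g \<otimes>\<^bsub>G\<^esub> y \<otimes>\<^bsub>G\<^esub> inv\<^bsub>G\<^esub> (\<phi> g))}"

definition reidemeister_number :: "('g, 'm) monoid_scheme \<Rightarrow> ('g \<Rightarrow> 'g) \<Rightarrow> enat" where
  "reidemeister_number G \<phi> =
    (if finite (carrier G // twisted_conj G \<phi>)
     then enat (card (carrier G // twisted_conj G \<phi>)) else \<infinity>)"

definition R_infinity :: "('g, 'm) monoid_scheme \<Rightarrow> bool" where
  "R_infinity G \<longleftrightarrow> (\<forall>\<phi>\<in>iso G G. reidemeister_number G \<phi> = \<infinity>)"

lemma equiv_twisted_conj:
  assumes "group G" "\<phi> \<in> iso G G"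
  shows "equiv (carrier G) (twisted_conj G \<phi>)"
proof -
  interpret group G by fact
  interpret h: group_hom G G \<phi>
    using assms by (simp add: group_hom_def group_hom_axioms_def iso_def)
  show ?thesis
  proof (rule equivI)
    show "twisted_conj G \<phi> \<subseteq> carrier G \<times> carrier G" by (auto simp: twisted_conj_def)
    show "refl_on (carrier G) (twisted_conj G \<phi>)"
      by (rule refl_onI) (auto simp: twisted_conj_def intro!: bexI[of _ "\<one>\<^bsub>G\<^esub>"])
    show "sym (twisted_conj G \<phi>)"
    proof (rule symI)
      fix x y assume "(x, y) \<in> twisted_conj G \<phi>"
      then obtain g where "g \<in> carrier G" "x = g \<otimes>\<^bsub>G\<^esub> y \<otimes>\<^bsub>G\<^esub> inv\<^bsub>G\<^esub> (\<phi> g)"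
        and "x \<in> carrier G" "y \<in> carrier G" by (auto simp: twisted_conj_def)
      then have "y = inv\<^bsub>G\<^esub> g \<otimes>\<^bsub>G\<^esub> x \<otimes>\<^bsub>G\<^esub> inv\<^bsub>G\<^esub> (\<phi> (inv\<^bsub>G\<^esub> g))"
        by (simp add: m_assoc inv_solve_left)
      with \<open>g \<in> carrier G\<close> \<open>x \<in> carrier G\<close> \<open>y \<in> carrier G\<close>
      show "(y, x) \<in> twisted_conj G \<phi>" unfolding twisted_conj_def by blast
    qed
    show "trans (twisted_conj G \<phi>)"
    proof (rule transI)
      fix x y z assume "(x, y) \<in> twisted_conj G \<phi>" "(y, z) \<in> twisted_conj G \<phi>"
      then obtain g k where gk: "g \<in> carrier G" "k \<in> carrier G"
        and xyz: "x \<in> carrier G" "y \<in> carrier G" "z \<in> carrier G"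
        and eq: "x = g \<otimes>\<^bsub>G\<^esub> y \<otimes>\<^bsub>G\<^esub> inv\<^bsub>G\<^esub> (\<phi> g)" "y = k \<otimes>\<^bsub>G\<^esub> z \<otimes>\<^bsub>G\<^esub> inv\<^bsub>G\<^esub> (\<phi> k)"
        by (auto simp: twisted_conj_def)
      have "x = (g \<otimes>\<^bsub>G\<^esub> k) \<otimes>\<^bsub>G\<^esub> z \<otimes>\<^bsub>G\<^esub> inv\<^bsub>G\<^esub> (\<phi> (g \<otimes>\<^bsub>G\<^esub> k))"
        unfolding eq(1) unfolding eq(2) using gk xyz by (simp add: m_assoc inv_mult_group)
      with gk xyz show "(x, z) \<in> twisted_conj G \<phi>" unfolding twisted_conj_def by blast
    qed
  qed
qed

end

theory Submission
  imports Defs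
    "HOL-Library.Function_Algebras"
    "HOL-Computational_Algebra.Formal_Power_Series"
    "HOL-Algebra.Generated_Groups"
    "HOL-Algebra.Elementary_Groups"
    "Jordan_Normal_Form.Jordan_Normal_Form_Existence"
begin

text \<open>
  Let \<open>G\<close> be the group, \<open>n\<close> the number of vertices, and \<open>D\<^sub>k\<close> the \<open>k\<close>-th dimension subgroup over the complex
  numbers, i.e. the set of all \<open>g\<close> such that \<open>g - 1\<close> lies in the \<open>k\<close>-th power of the augmentation ideal of
  the group ring. An automorphism \<open>\<phi>\<close> acts on every layer \<open>D\<^sub>k / D\<^sub>k\<^sub>+\<^sub>1\<close>, which is a finitely generated
  torsion-free abelian group.
  
  Eigenvalue one gives infinitely many classes. Suppose that \<open>c\<close> is minimal such that \<open>\<phi>\<close> has the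
  eigenvalue one on layer \<open>c\<close>. Then there are an additive \<open>\<phi>\<close>-invariant function \<open>f\<close> on \<open>D\<^sub>c\<close> and an
  \<open>a \<in> D\<^sub>c\<close> with \<open>f a \<noteq> 0\<close>. Suppose that \<open>a\<^sup>r = g a\<^sup>s (\<phi> g)\<^sup>-\<^sup>1\<close>. As long as \<open>g\<close> lies in \<open>D\<^sub>k\<close> with \<open>k < c\<close>, its
  class in layer \<open>k\<close> is fixed by \<open>\<phi>\<close>, hence trivial, and \<open>g\<close> lies in \<open>D\<^sub>k\<^sub>+\<^sub>1\<close>. So \<open>g\<close> descends to \<open>D\<^sub>c\<close>, and applying
  \<open>f\<close> gives \<open>r = s\<close>.
  Hence the powers of \<open>a\<close> are pairwise not \<open>\<phi>\<close>-conjugate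
  (\<open>infinite_reidemeister_if_not_layer_onto\<close>).
  
  Eigenvalue one occurs in layer \<open>2 n\<close>. On the first layer \<open>\<phi>\<close> acts by a matrix that is invertible over
  the integers, hence has determinant \<open>1\<close> or \<open>-1\<close>. Let \<open>u\<^sub>1, \<dots>, u\<^sub>n\<close> be a basis of generalized eigenvectors
  of its complexification, with eigenvalues \<open>l\<^sub>1, \<dots>, l\<^sub>n\<close> (\<open>generalized_eigenbasis\<close>). The layers form a Lie
  ring under commutators, on which \<open>\<phi>\<close> acts by automorphisms. An iterated bracket in which every \<open>u\<^sub>j\<close>
  occurs twice is therefore killed by a power of \<open>\<phi> - (l\<^sub>1 \<cdots> l\<^sub>n)\<^sup>2 = \<phi> - 1\<close>
  (\<open>lie_functional_killed\<close>), and it remains to find such a bracket that is not zero.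
  
  This is where disconnectedness enters. Let \<open>C\<close> be a union of components. If all vertices in \<open>C\<close> are sent
  to multiples of one matrix and all other vertices to multiples of another one, then adjacent vertices get
  commuting images \<open>z\<^sub>v\<close>, so \<open>v \<mapsto> 1 + z\<^sub>v X\<close> extends to a homomorphism into the power series over the
  \<open>2 \<times> 2\<close> matrices. It sends a bracket of the \<open>u\<^sub>j\<close> to the same bracket of linear combinations of the two
  matrices. For antidiagonal matrices such brackets are computed by closed formulas
  (\<open>lie_bracket_antidiag_nonzero\<close>), and they do not vanish if the multiples are generic
  (\<open>generic_weights\<close>).
  
  The group ring is avoided by duality: \<open>poly_funs k\<close> consists of the functions on \<open>G\<close> whose linear extension
  kills the \<open>k\<close>-th power of the augmentation ideal. The complexification of layer \<open>k\<close> is dual to the space of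
  the restrictions of \<open>poly_funs (Suc k)\<close> to \<open>D\<^sub>k\<close> modulo constants, and brackets of vectors become functionals on these spaces.
\<close>

section \<open>Generalized eigenvectors of complex matrices\<close>

text \<open>
  Vectors of length \<open>n\<close> are functions that vanish outside \<open>{..<n}\<close>, so that they are equal as functions as soon
  as their entries agree.
\<close>

definition mat_op :: "nat \<Rightarrow> (nat \<Rightarrow> nat \<Rightarrow> complex) \<Rightarrow> (nat \<Rightarrow> complex) \<Rightarrow> nat \<Rightarrow> complex" where
  "mat_op n M u = (\<lambda>i. if i < n then \<Sum>k<n. M i k * u k else 0)"

definition shifted_op :: "nat \<Rightarrow> (nat \<Rightarrow> nat \<Rightarrow> complex) \<Rightarrow> complex \<Rightarrow> (nat \<Rightarrow> complex) \<Rightarrow> nat \<Rightarrow> complex" where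
  "shifted_op n M l u = (\<lambda>i. mat_op n M u i - l * u i)"

definition bidiag :: "'a::zero mat \<Rightarrow> nat \<Rightarrow> bool" where
  "bidiag A n \<longleftrightarrow> (\<forall>i<n. \<forall>j<n. i \<noteq> j \<longrightarrow> A $$ (i,j) \<noteq> 0 \<longrightarrow> j = Suc i \<and> A $$ (i,i) = A $$ (j,j))"

text \<open>
  All that is used about Jordan matrices: each column has, besides its diagonal entry, at most one non-zero
  entry, and this one links two columns with the same eigenvalue.
\<close>

lemma bidiag_jordan_matrix:
  "bidiag (jordan_matrix (n_as :: (nat \<times> 'a::{zero,one}) list)) (sum_list (map fst n_as))"
proof (induction n_as)
  case Nil
  then show ?case by (simp add: bidiag_def)
next
  case (Cons na n_as)
  obtain n a where na: "na = (n,a)" by force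
  let ?N = "sum_list (map fst n_as)"
  have d: "dim_row (jordan_block n a) = n" "dim_col (jordan_block n a) = n"
    "dim_row (jordan_matrix n_as) = ?N" "dim_col (jordan_matrix n_as) = ?N"
    by (simp_all add: jordan_block_def)
  show ?case
    unfolding bidiag_def
  proof (intro allI impI)
    fix i j
    let ?J = "jordan_matrix (na # n_as)"
    assume ij: "i < sum_list (map fst (na # n_as))" "j < sum_list (map fst (na # n_as))" "i \<noteq> j"
      and nz: "?J $$ (i,j) \<noteq> 0"
    have J: "?J $$ (i',j') = (if i' < n then if j' < n then jordan_block n a $$ (i',j') else 0
       else if j' < n then 0 else jordan_matrix n_as $$ (i' - n, j' - n))"
      if "i' < n + ?N" "j' < n + ?N" for i' j'
      using that unfolding na jordan_matrix_Cons four_block_mat_def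
      by (auto simp: d Let_def)
    have ij': "i < n + ?N" "j < n + ?N" using ij na by auto
    show "j = Suc i \<and> ?J $$ (i,i) = ?J $$ (j,j)"
    proof (cases "i < n")
      case True
      then have "j < n" using nz J[OF ij'] by (auto split: if_splits)
      then show ?thesis using True nz J[OF ij'] J[OF ij'(1) ij'(1)] J[OF ij'(2) ij'(2)] ij(3)
        by (auto split: if_splits)
    next
      case False
      then have j: "\<not> j < n" using nz J[OF ij'] by (auto split: if_splits)
      obtain i' j' where e: "i = n + i'" "j = n + j'" using False j by (metis le_iff_add not_less)
      then have b: "i' < ?N" "j' < ?N" "i' \<noteq> j'" using ij' ij(3) by auto
      have "jordan_matrix n_as $$ (i', j') \<noteq> 0" using nz J[OF ij'] e by simp
      with Cons.IH b have "j' = Suc i' \<and> jordan_matrix n_as $$ (i',i') = jordan_matrix n_as $$ (j',j')"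
        unfolding bidiag_def by blast
      then show ?thesis using J[OF ij'(1) ij'(1)] J[OF ij'(2) ij'(2)] e by simp
    qed
  qed
qed

lemma shifted_op_pow_zero: "(shifted_op n M l ^^ K) (\<lambda>_. 0) = (\<lambda>_. 0)"
  by (induction K) (auto simp: shifted_op_def mat_op_def fun_eq_iff)

lemma shifted_op_pow_smult:
  "(shifted_op n M l ^^ K) (\<lambda>i. c * u i) = (\<lambda>i. c * (shifted_op n M l ^^ K) u i)"
proof (induction K)
  case (Suc K)
  then show ?case by (simp add: shifted_op_def mat_op_def fun_eq_iff sum_distrib_left algebra_simps)
qed simp

text \<open>
  The columns \<open>u j\<close> of a matrix \<open>P\<close> that conjugates \<open>M\<close> to Jordan form. That they form a basis is
  expressed by coefficients \<open>c\<close> of the standard basis vectors, taken from the inverse of \<open>P\<close>; this is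
  the form in which it is used later.
\<close>

lemma generalized_eigenbasis:
  fixes M :: "nat \<Rightarrow> nat \<Rightarrow> complex"
  obtains l :: "nat \<Rightarrow> complex" and u c :: "nat \<Rightarrow> nat \<Rightarrow> complex"
  where "\<And>j. j < n \<Longrightarrow> \<exists>K. (shifted_op n M (l j) ^^ K) (u j) = (\<lambda>_. 0)"
    and "\<And>i k. i < n \<Longrightarrow> k < n \<Longrightarrow> (\<Sum>j<n. c i j * u j k) = (if k = i then 1 else 0)"
    and "\<And>j. j < n \<Longrightarrow> \<exists>k<n. u j k \<noteq> 0"
    and "(\<Prod>j<n. l j) = Determinant.det (mat n n (\<lambda>(i,j). M i j))"
proof -
  let ?A = "mat n n (\<lambda>(i,j). M i j)"
  have A: "?A \<in> carrier_mat n n" by simp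
  obtain as where "char_poly ?A = (\<Prod>a\<leftarrow>as. [:- a, 1:])" using char_poly_factorized[OF A] by auto
  from jordan_nf_exists[OF A this] obtain n_as where jnf: "jordan_nf ?A n_as" ..
  define J where "J = jordan_matrix n_as"
  have sim: "similar_mat ?A J" using jnf unfolding jordan_nf_def J_def by auto
  then obtain P Q where "similar_mat_wit ?A J P Q" unfolding similar_mat_def by auto
  from similar_mat_witD2[OF A this]
  have PQ: "P * Q = 1\<^sub>m n" "Q * P = 1\<^sub>m n" "?A = P * J * Q"
    and J: "J \<in> carrier_mat n n" and P: "P \<in> carrier_mat n n" and Q: "Q \<in> carrier_mat n n" by auto
  have n: "sum_list (map fst n_as) = n" using J unfolding J_def by auto
  have bd: "bidiag J n" using bidiag_jordan_matrix[of n_as] n unfolding J_def by simp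
  define u where "u = (\<lambda>j i. if i < n then P $$ (i,j) else 0)"
  define l where "l = (\<lambda>j. J $$ (j,j))"
  define c where "c = (\<lambda>i j. Q $$ (j,i))"
  have AP: "?A * P = P * J"
  proof -
    have "?A * P = P * J * (Q * P)" unfolding PQ(3) using P J Q by (simp add: assoc_mult_mat[of _ n n _ n _ n])
    also have "\<dots> = P * J" unfolding PQ(2) using P J by simp
    finally show ?thesis .
  qed
  have step: "mat_op n M (u j) i = (\<Sum>k<n. u k i * J $$ (k,j))" if "j < n" for i j
  proof (cases "i < n")
    case True
    have "mat_op n M (u j) i = (?A * P) $$ (i,j)"
      using True that P by (simp add: mat_op_def u_def scalar_prod_def atLeast0LessThan)
    also have "\<dots> = (P * J) $$ (i,j)" unfolding AP ..
    also have "\<dots> = (\<Sum>k<n. u k i * J $$ (k,j))"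
      using True that P J by (simp add: u_def scalar_prod_def atLeast0LessThan)
    finally show ?thesis .
  qed (simp add: mat_op_def u_def)
  have off: "J $$ (k,j) = 0" if "k < n" "j < n" "k \<noteq> j" "j \<noteq> Suc k" for k j
    using bd that unfolding bidiag_def by blast
  have gen: "(shifted_op n M (l j) ^^ Suc j) (u j) = (\<lambda>_. 0)" if "j < n" for j
    using that
  proof (induction j)
    case 0
    have "(\<Sum>k<n. u k i * J $$ (k,0)) = (\<Sum>k<n. if k = 0 then u 0 i * l 0 else 0)" for i
      using 0 by (intro sum.cong) (simp_all add: l_def off)
    with 0 show ?case by (simp add: shifted_op_def step fun_eq_iff)
  next
    case (Suc j)
    have "(\<Sum>k<n. u k i * J $$ (k,Suc j)) =
        (\<Sum>k<n. (if k = Suc j then u (Suc j) i * l (Suc j) else 0) + (if k = j then u j i * J $$ (j, Suc j) else 0))" for i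
      using Suc.prems by (intro sum.cong) (simp_all add: l_def off)
    with Suc have *: "shifted_op n M (l (Suc j)) (u (Suc j)) = (\<lambda>i. J $$ (j, Suc j) * u j i)"
      by (simp add: shifted_op_def step fun_eq_iff sum.distrib)
    have "(shifted_op n M (l (Suc j)) ^^ Suc j) (\<lambda>i. J $$ (j, Suc j) * u j i) = (\<lambda>_. 0)"
    proof (cases "J $$ (j, Suc j) = 0")
      case True
      then show ?thesis by (simp only: mult_zero_left shifted_op_pow_zero)
    next
      case False
      with bd Suc.prems have "l (Suc j) = l j" unfolding bidiag_def l_def by (metis Suc_lessD n_not_Suc_n)
      then show ?thesis using Suc.IH Suc.prems by (simp add: shifted_op_pow_smult del: funpow.simps)
    qed
    then show ?case by (subst funpow_Suc_right) (simp add: * del: funpow.simps)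
  qed
  show thesis
  proof
    show "\<exists>K. (shifted_op n M (l j) ^^ K) (u j) = (\<lambda>_. 0)" if "j < n" for j using gen[OF that] by blast
    show "(\<Sum>j<n. c i j * u j k) = (if k = i then 1 else 0)" if "i < n" "k < n" for i k
    proof -
      have "(\<Sum>j<n. c i j * u j k) = (P * Q) $$ (k,i)"
        using that P Q by (simp add: u_def c_def scalar_prod_def atLeast0LessThan mult.commute)
      also have "\<dots> = (if k = i then 1 else 0)" using that by (simp add: PQ(1))
      finally show ?thesis .
    qed
    show "\<exists>k<n. u j k \<noteq> 0" if "j < n" for j
    proof (rule ccontr)
      assume z: "\<not> ?thesis"
      have "(Q * P) $$ (j,j) = (\<Sum>k<n. Q $$ (j,k) * u j k)"
        using that P Q by (simp add: u_def scalar_prod_def atLeast0LessThan)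
      also have "\<dots> = 0" using z by (intro sum.neutral) auto
      finally show False using that by (simp add: PQ(2))
    qed
    have "upper_triangular J" using jordan_matrix_upper_triangular[of _ n_as] n J
      unfolding J_def upper_triangular_def by auto
    then have "Determinant.det J = prod_list (diag_mat J)" using det_upper_triangular J by blast
    also have "\<dots> = (\<Prod>j<n. l j)" using J by (simp add: prod_list_diag_prod l_def atLeast0LessThan)
    finally show "(\<Prod>j<n. l j) = Determinant.det ?A" using det_similar[OF sim] by simp
  qed
qed

lemma det_square_eq_1_if_int_inverse:
  fixes M M' :: "nat \<Rightarrow> nat \<Rightarrow> int"
  assumes "\<And>i k. i < n \<Longrightarrow> k < n \<Longrightarrow> (\<Sum>j<n. M' i j * M j k) = (if i = k then 1 else 0)"
  shows "(Determinant.det (mat n n (\<lambda>(i,j). complex_of_int (M i j))))\<^sup>2 = 1"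
proof -
  let ?A = "mat n n (\<lambda>(i,j). M i j)" and ?B = "mat n n (\<lambda>(i,j). M' i j)"
  have "?B * ?A = 1\<^sub>m n"
    by (rule eq_matI) (auto simp: scalar_prod_def atLeast0LessThan assms)
  then have "Determinant.det ?B * Determinant.det ?A = 1"
    using det_mult[of ?B n ?A] by simp
  then have *: "(Determinant.det ?A)\<^sup>2 = 1" by (auto simp: zmult_eq_1_iff)
  have "mat n n (\<lambda>(i,j). complex_of_int (M i j)) = map_mat of_int ?A"
    by (rule eq_matI) auto
  then have "Determinant.det (mat n n (\<lambda>(i,j). complex_of_int (M i j))) = of_int (Determinant.det ?A)"
    by (simp only: of_int_hom.hom_det)
  then show ?thesis using * by (metis of_int_1 of_int_power)
qed

section \<open>Polynomial functions and dimension subgroups\<close>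

context group
begin

text \<open>
  Functions on the carrier are represented by functions on the whole type that vanish outside the carrier,
  so that equality of functions is equality on the carrier.
\<close>

definition pull :: "('a \<Rightarrow> 'a) \<Rightarrow> ('a \<Rightarrow> complex) \<Rightarrow> 'a \<Rightarrow> complex" where
  "pull \<phi> f = (\<lambda>x. if x \<in> carrier G then f (\<phi> x) else 0)"

text \<open>
  Functions all of whose \<open>k\<close>-fold differences vanish. Since the difference in direction \<open>h\<close> is dual to
  multiplication by \<open>h - 1\<close> in the group ring, these are the functions whose linear extension kills the
  \<open>k\<close>-th power of the augmentation ideal; in particular \<open>poly_funs 1\<close> consists of the constants.
\<close>

fun poly_funs :: "nat \<Rightarrow> ('a \<Rightarrow> complex) set" where
  "poly_funs 0 = {\<lambda>_. 0}"
| "poly_funs (Suc k) = {f. (\<forall>x. x \<notin> carrier G \<longrightarrow> f x = 0) \<and>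
     (\<forall>h\<in>carrier G. (\<lambda>x. pull (\<lambda>x. x \<otimes> h) f x - f x) \<in> poly_funs k)}"

lemma poly_funs_SucI:
  assumes "\<And>x. x \<notin> carrier G \<Longrightarrow> f x = 0"
    and "\<And>h. h \<in> carrier G \<Longrightarrow> (\<lambda>x. pull (\<lambda>x. x \<otimes> h) f x - f x) \<in> poly_funs k"
  shows "f \<in> poly_funs (Suc k)"
  using assms by simp

lemma right_difference:
  "f \<in> poly_funs (Suc k) \<Longrightarrow> h \<in> carrier G \<Longrightarrow> (\<lambda>x. pull (\<lambda>x. x \<otimes> h) f x - f x) \<in> poly_funs k"
  by simp

lemma poly_funs_outside: "f \<in> poly_funs k \<Longrightarrow> x \<notin> carrier G \<Longrightarrow> f x = 0"
  by (cases k) auto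

lemma poly_funs_0D: "f \<in> poly_funs 0 \<Longrightarrow> f = (\<lambda>_. 0)"
  by simp

lemma poly_funs_zero: "(\<lambda>_. 0) \<in> poly_funs k"
  by (induction k) (auto simp: pull_def)

declare poly_funs.simps [simp del]

text \<open>
  The elements \<open>g\<close> such that \<open>g - 1\<close> lies in the \<open>k\<close>-th power of the augmentation ideal of the complex group
  ring.
\<close>

definition dim_subgroup :: "nat \<Rightarrow> 'a set" where
  "dim_subgroup k = {g \<in> carrier G. \<forall>f\<in>poly_funs k. f g = f \<one>}"

lemma poly_funs_add: "f \<in> poly_funs k \<Longrightarrow> g \<in> poly_funs k \<Longrightarrow> (\<lambda>x. f x + g x) \<in> poly_funs k"
proof (induction k arbitrary: f g)
  case 0
  then show ?case by (simp add: poly_funs.simps)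
next
  case (Suc k)
  show ?case
  proof (rule poly_funs_SucI)
    fix h assume h: "h \<in> carrier G"
    show "(\<lambda>x. pull (\<lambda>x. x \<otimes> h) (\<lambda>x. f x + g x) x - (f x + g x)) \<in> poly_funs k"
      using Suc.IH[OF right_difference[OF Suc.prems(1) h] right_difference[OF Suc.prems(2) h]]
      by (rule back_subst[of "\<lambda>f. f \<in> _"]) (auto simp: pull_def fun_eq_iff)
  qed (simp add: poly_funs_outside[OF Suc.prems(1)] poly_funs_outside[OF Suc.prems(2)])
qed

lemma poly_funs_scale: "f \<in> poly_funs k \<Longrightarrow> (\<lambda>x. c * f x) \<in> poly_funs k"
proof (induction k arbitrary: f)
  case 0
  then show ?case by (simp add: poly_funs.simps)
next
  case (Suc k)
  show ?case
  proof (rule poly_funs_SucI)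
    fix h assume h: "h \<in> carrier G"
    show "(\<lambda>x. pull (\<lambda>x. x \<otimes> h) (\<lambda>x. c * f x) x - c * f x) \<in> poly_funs k"
      using Suc.IH[OF right_difference[OF Suc.prems h]]
      by (rule back_subst[of "\<lambda>f. f \<in> _"]) (auto simp: pull_def fun_eq_iff algebra_simps)
  qed (simp add: poly_funs_outside[OF Suc.prems])
qed

lemma poly_funs_diff: "f \<in> poly_funs k \<Longrightarrow> g \<in> poly_funs k \<Longrightarrow> (\<lambda>x. f x - g x) \<in> poly_funs k"
  using poly_funs_add[OF _ poly_funs_scale[of g k "-1"]] by simp

lemma poly_funs_sum: "(\<And>i. i \<in> I \<Longrightarrow> F i \<in> poly_funs k) \<Longrightarrow> (\<lambda>x. \<Sum>i\<in>I. F i x) \<in> poly_funs k"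
  by (induction I rule: infinite_finite_induct) (auto intro: poly_funs_zero poly_funs_add)

lemma poly_funs_Suc: "f \<in> poly_funs k \<Longrightarrow> f \<in> poly_funs (Suc k)"
proof (induction k arbitrary: f)
  case 0
  then show ?case using poly_funs_0D poly_funs_zero by blast
next
  case (Suc k)
  show ?case
    by (rule poly_funs_SucI) (use Suc right_difference poly_funs_outside in blast)+
qed

lemma right_shift:
  assumes "f \<in> poly_funs k" "h \<in> carrier G"
  shows "pull (\<lambda>x. x \<otimes> h) f \<in> poly_funs k"
proof -
  have "(\<lambda>x. pull (\<lambda>x. x \<otimes> h) f x - f x) \<in> poly_funs k"
    using right_difference[of f k h] poly_funs_Suc assms by blast
  from poly_funs_add[OF this assms(1)] show ?thesis by simp
qed

lemma left_shift:
  assumes h: "h \<in> carrier G"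
  shows "f \<in> poly_funs k \<Longrightarrow> pull ((\<otimes>) h) f \<in> poly_funs k"
proof (induction k arbitrary: f)
  case 0
  then show ?case by (auto simp: pull_def poly_funs.simps)
next
  case (Suc k)
  show ?case
  proof (rule poly_funs_SucI)
    fix g assume g: "g \<in> carrier G"
    show "(\<lambda>x. pull (\<lambda>x. x \<otimes> g) (pull ((\<otimes>) h) f) x - pull ((\<otimes>) h) f x) \<in> poly_funs k"
      using Suc.IH[OF right_difference[OF Suc.prems g]]
      by (rule back_subst[of "\<lambda>f. f \<in> _"]) (use h g in \<open>simp add: pull_def fun_eq_iff m_assoc\<close>)
  qed (simp add: pull_def)
qed

text \<open>
  The powers of the augmentation ideal are two-sided ideals, so left differences lower the degree as right
  differences do.
\<close>

lemma left_difference: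
  assumes h: "h \<in> carrier G"
  shows "f \<in> poly_funs (Suc k) \<Longrightarrow> (\<lambda>x. pull ((\<otimes>) h) f x - f x) \<in> poly_funs k"
proof (induction k arbitrary: f)
  case 0
  have *: "f x = f \<one>" if "x \<in> carrier G" for x
    using fun_cong[OF poly_funs_0D[OF right_difference[OF 0 that]], of \<one>] that by (simp add: pull_def)
  have "pull ((\<otimes>) h) f x - f x = 0" for x
    using *[of x] *[of "h \<otimes> x"] h poly_funs_outside[OF 0, of x] by (cases "x \<in> carrier G") (simp_all add: pull_def)
  then show ?case by (simp add: poly_funs.simps)
next
  case (Suc k)
  show ?case
  proof (rule poly_funs_SucI)
    fix g assume g: "g \<in> carrier G"
    show "(\<lambda>x. pull (\<lambda>x. x \<otimes> g) (\<lambda>x. pull ((\<otimes>) h) f x - f x) x - (pull ((\<otimes>) h) f x - f x)) \<in> poly_funs k"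
      using Suc.IH[OF right_difference[OF Suc.prems g]]
      by (rule back_subst[of "\<lambda>f. f \<in> _"]) (use h g in \<open>simp add: pull_def fun_eq_iff m_assoc\<close>)
  qed (use poly_funs_outside[OF Suc.prems] in \<open>simp add: pull_def\<close>)
qed

lemma pull_hom:
  assumes \<phi>: "\<phi> \<in> hom G G"
  shows "f \<in> poly_funs k \<Longrightarrow> pull \<phi> f \<in> poly_funs k"
proof (induction k arbitrary: f)
  case 0
  then show ?case by (auto simp: pull_def poly_funs.simps)
next
  case (Suc k)
  show ?case
  proof (rule poly_funs_SucI)
    fix g assume g: "g \<in> carrier G"
    show "(\<lambda>x. pull (\<lambda>x. x \<otimes> g) (pull \<phi> f) x - pull \<phi> f x) \<in> poly_funs k"
      using Suc.IH[OF right_difference[OF Suc.prems hom_in_carrier[OF \<phi> g]]]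
      by (rule back_subst[of "\<lambda>f. f \<in> _"])
        (use g in \<open>simp add: pull_def fun_eq_iff hom_mult[OF \<phi>] hom_in_carrier[OF \<phi>]\<close>)
  qed (simp add: pull_def)
qed

lemma dim_subgroup_carrier: "d \<in> dim_subgroup k \<Longrightarrow> d \<in> carrier G"
  by (simp add: dim_subgroup_def)

lemma dim_subgroupD: "d \<in> dim_subgroup k \<Longrightarrow> f \<in> poly_funs k \<Longrightarrow> f d = f \<one>"
  by (simp add: dim_subgroup_def)

lemma dim_subgroup_one: "\<one> \<in> dim_subgroup k"
  by (simp add: dim_subgroup_def)

lemma dim_subgroup_antimono: "d \<in> dim_subgroup (Suc k) \<Longrightarrow> d \<in> dim_subgroup k"
  using poly_funs_Suc by (auto simp: dim_subgroup_def)

lemma dim_subgroup_mult: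
  assumes "d \<in> dim_subgroup k" "d' \<in> dim_subgroup k"
  shows "d \<otimes> d' \<in> dim_subgroup k"
proof -
  have c: "d \<in> carrier G" "d' \<in> carrier G" using assms dim_subgroup_carrier by auto
  have "f (d \<otimes> d') = f \<one>" if "f \<in> poly_funs k" for f
    using dim_subgroupD[OF assms(1) right_shift[OF that c(2)]] dim_subgroupD[OF assms(2) that] c
    by (simp add: pull_def)
  with c show ?thesis by (simp add: dim_subgroup_def)
qed

lemma dim_subgroup_pow: "d \<in> dim_subgroup k \<Longrightarrow> d [^] (m::nat) \<in> dim_subgroup k"
  by (induction m) (auto intro: dim_subgroup_mult dim_subgroup_one)

lemma dim_subgroup_hom:
  assumes "\<phi> \<in> hom G G" "d \<in> dim_subgroup k"
  shows "\<phi> d \<in> dim_subgroup k"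
proof -
  have "f (\<phi> d) = f \<one>" if "f \<in> poly_funs k" for f
    using dim_subgroupD[OF assms(2) pull_hom[OF assms(1) that]] dim_subgroup_carrier[OF assms(2)]
    by (simp add: pull_def hom_one[OF assms(1) is_group is_group])
  then show ?thesis using hom_in_carrier[OF assms(1)] assms(2) by (simp add: dim_subgroup_def)
qed

text \<open>
  In the group ring \<open>d x - d - x + 1 = (d - 1) (x - 1)\<close>, which lies one step deeper than \<open>d - 1\<close>. Hence
  functions in \<open>poly_funs (Suc k)\<close> are additive, up to a constant, on \<open>dim_subgroup k\<close>.
\<close>

lemma poly_fun_mult_left:
  assumes f: "f \<in> poly_funs (Suc k)" and d: "d \<in> dim_subgroup k" and x: "x \<in> carrier G"
  shows "f (d \<otimes> x) = f d + f x - f \<one>"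
  using dim_subgroupD[OF d right_difference[OF f x]] dim_subgroup_carrier[OF d] x
  by (simp add: pull_def algebra_simps)

lemma poly_fun_mult_right:
  assumes f: "f \<in> poly_funs (Suc k)" and d: "d \<in> dim_subgroup k" and x: "x \<in> carrier G"
  shows "f (x \<otimes> d) = f d + f x - f \<one>"
  using dim_subgroupD[OF d left_difference[OF x f]] dim_subgroup_carrier[OF d] x
  by (simp add: pull_def algebra_simps)

lemma poly_fun_pow:
  assumes f: "f \<in> poly_funs (Suc k)" and d: "d \<in> dim_subgroup k"
  shows "f (d [^] (m::nat)) - f \<one> = of_nat m * (f d - f \<one>)"
proof (induction m)
  case (Suc m)
  have "f (d [^] m \<otimes> d) = f d + f (d [^] m) - f \<one>"
    using poly_fun_mult_right[OF f d, of "d [^] m"] dim_subgroup_carrier[OF d] by simp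
  then have "f (d [^] Suc m) - f \<one> = (f d - f \<one>) + (f (d [^] m) - f \<one>)" by simp
  then show ?case unfolding Suc by (simp add: ring_distribs)
qed simp

text \<open>
  The dual of the map \<open>x \<mapsto> x g - g x\<close> on the group ring, i.e. of the Lie bracket with \<open>g - 1\<close>.
\<close>

definition bracket_diff :: "'a \<Rightarrow> ('a \<Rightarrow> complex) \<Rightarrow> 'a \<Rightarrow> complex" where
  "bracket_diff g f = (\<lambda>x. if x \<in> carrier G then f (x \<otimes> g) - f (g \<otimes> x) else 0)"

lemma bracket_diff_poly_funs:
  assumes f: "f \<in> poly_funs (Suc k)" and g: "g \<in> carrier G"
  shows "bracket_diff g f \<in> poly_funs k"
proof -
  have "(\<lambda>x. (pull (\<lambda>x. x \<otimes> g) f x - f x) - (pull ((\<otimes>) g) f x - f x)) \<in> poly_funs k"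
    by (intro poly_funs_diff right_difference left_difference f g)
  then show ?thesis
    by (rule back_subst[of "\<lambda>f. f \<in> _"]) (auto simp: pull_def fun_eq_iff bracket_diff_def)
qed

lemma commutator_dim_subgroup:
  assumes d: "d \<in> dim_subgroup k" and g: "g \<in> carrier G"
  shows "d \<otimes> g \<otimes> inv (g \<otimes> d) \<in> dim_subgroup (Suc k)"
proof -
  have dc: "d \<in> carrier G" using d by (rule dim_subgroup_carrier)
  have "f (d \<otimes> g \<otimes> inv (g \<otimes> d)) = f \<one>" if f: "f \<in> poly_funs (Suc k)" for f
  proof -
    let ?y = "inv (g \<otimes> d)"
    have y: "?y \<in> carrier G" using g dc by simp
    note f' = right_shift[OF f y]
    show ?thesis
      using poly_fun_mult_left[OF f' d g] poly_fun_mult_right[OF f' d g] dc g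
      by (simp add: pull_def)
  qed
  with dc g show ?thesis by (simp add: dim_subgroup_def)
qed

text \<open>
  The Lie bracket with \<open>g - 1\<close> maps layer \<open>k\<close> to layer \<open>k + 1\<close>, because it is realized there by the group
  commutator with \<open>g\<close>. Dually, \<open>bracket_diff\<close> preserves being trivial on the respective layers.
\<close>

lemma bracket_diff_const:
  assumes f: "f \<in> poly_funs (Suc (Suc k))" and c: "\<And>x. x \<in> dim_subgroup (Suc k) \<Longrightarrow> f x = f \<one>"
    and g: "g \<in> carrier G" and d: "d \<in> dim_subgroup k"
  shows "bracket_diff g f d = 0"
proof -
  have dc: "d \<in> carrier G" using d by (rule dim_subgroup_carrier)
  let ?c = "d \<otimes> g \<otimes> inv (g \<otimes> d)"
  have "d \<otimes> g = ?c \<otimes> (g \<otimes> d)" using dc g by (simp add: m_assoc)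
  also have "f \<dots> = f ?c + f (g \<otimes> d) - f \<one>"
    using poly_fun_mult_left[OF f commutator_dim_subgroup[OF d g]] g dc by blast
  also have "f ?c = f \<one>" using c commutator_dim_subgroup[OF d g] by blast
  finally show ?thesis using dc by (simp add: bracket_diff_def)
qed

text \<open>
  Up to lower order, \<open>bracket_diff g\<close> is additive in \<open>g\<close>, so that it only depends on the class of \<open>g\<close> in the
  abelianization.
\<close>

lemma bracket_diff_mult:
  assumes f: "f \<in> poly_funs (Suc (Suc k))" and g: "g \<in> carrier G" and g': "g' \<in> carrier G"
  shows "(\<lambda>x. bracket_diff (g \<otimes> g') f x - bracket_diff g f x - bracket_diff g' f x) \<in> poly_funs k"
proof -
  let ?r = "\<lambda>g f x. pull (\<lambda>x. x \<otimes> g) f x - f x" and ?l = "\<lambda>g f x. pull ((\<otimes>) g) f x - f x"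
  have "(\<lambda>x. ?r g (?r g' f) x - ?l g' (?l g f) x) \<in> poly_funs k"
    by (intro poly_funs_diff right_difference left_difference f g g')
  then show ?thesis
    by (rule back_subst[of "\<lambda>f. f \<in> _"])
      (use g g' in \<open>auto simp: pull_def fun_eq_iff bracket_diff_def m_assoc\<close>)
qed

text \<open>
  This bounds the dimension of \<open>poly_funs k\<close>: a function whose differences along generators vanish is
  constant, so the points for \<open>Suc k\<close> are the points for \<open>k\<close>, their translates by generators, and the
  identity.
\<close>

lemma poly_funs_determined:
  assumes S: "finite S" "generate G S = carrier G" "S \<subseteq> carrier G"
  shows "\<exists>X. finite X \<and> (\<forall>f\<in>poly_funs k. (\<forall>x\<in>X. f x = 0) \<longrightarrow> f = (\<lambda>_. 0))"
proof (induction k)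
  case 0
  then show ?case using poly_funs_0D by blast
next
  case (Suc k)
  then obtain X where X: "finite X" "\<And>f. f \<in> poly_funs k \<Longrightarrow> \<forall>x\<in>X. f x = 0 \<Longrightarrow> f = (\<lambda>_. 0)"
    by blast
  let ?Y = "insert \<one> (X \<union> (\<Union>s\<in>S. (\<lambda>x. x \<otimes> s) ` X))"
  have "f = (\<lambda>_. 0)" if f: "f \<in> poly_funs (Suc k)" and z: "\<forall>x\<in>?Y. f x = 0" for f
  proof -
    have zX: "f x = 0" "f (x \<otimes> s) = 0" if "x \<in> X" "s \<in> S" for x s using z that by blast+
    have s: "f (x \<otimes> s) = f x" if "s \<in> S" "x \<in> carrier G" for s x
    proof -
      have "(\<lambda>x. pull (\<lambda>x. x \<otimes> s) f x - f x) = (\<lambda>_. 0)"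
        using S that by (intro X(2) right_difference f) (auto simp: pull_def zX poly_funs_outside[OF f])
      from fun_cong[OF this, of x] that show ?thesis by (simp add: pull_def)
    qed
    have "\<forall>x\<in>carrier G. f (x \<otimes> h) = f x" if "h \<in> generate G S" for h
      using that
    proof induction
      case (inv h)
      then have h: "h \<in> carrier G" using S by auto
      show ?case
      proof
        fix x assume x: "x \<in> carrier G"
        have "f (x \<otimes> inv h \<otimes> h) = f (x \<otimes> inv h)" using s inv x h by simp
        then show "f (x \<otimes> inv h) = f x" using x h by (simp add: m_assoc)
      qed
    next
      case (eng h1 h2)
      then have "h1 \<in> carrier G" "h2 \<in> carrier G" using S by auto
      with eng show ?case by (simp add: m_assoc[symmetric])
    qed (auto simp: s)
    then have "f (\<one> \<otimes> h) = f \<one>" if "h \<in> carrier G" for h using that S(2) by blast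
    then have "f h = 0" if "h \<in> carrier G" for h using that z by simp
    with poly_funs_outside[OF f] show ?thesis by blast
  qed
  with X(1) S(1) show ?case by (intro exI[of _ ?Y]) auto
qed

end

section \<open>Finite-dimensional spaces of functions\<close>

interpretation fun_space: vector_space "\<lambda>(c::complex) (f::'b \<Rightarrow> complex) x. c * f x"
  by standard (auto simp: fun_eq_iff algebra_simps)

lemma linear_funI:
  assumes "\<And>f g. S (\<lambda>x. f x + g x) = (\<lambda>x. S f x + S g x)" and "\<And>c f. S (\<lambda>x. c * f x) = (\<lambda>x. c * S f x)"
  shows "Vector_Spaces.linear (\<lambda>(c::complex) (f::'b \<Rightarrow> complex) x. c * f x)
    (\<lambda>(c::complex) (f::'c \<Rightarrow> complex) x. c * f x) S"
  using assms by unfold_locales (auto simp: plus_fun_def)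

text \<open>
  Restriction to \<open>X\<close> embeds \<open>U\<close> into the span of the indicator functions of the points of \<open>X\<close>.
\<close>

lemma finite_span_if_determined:
  fixes U :: "('b \<Rightarrow> complex) set"
  assumes U: "fun_space.subspace U" and X: "finite X"
    and det: "\<And>f. f \<in> U \<Longrightarrow> \<forall>x\<in>X. f x = 0 \<Longrightarrow> f = (\<lambda>_. 0)"
  obtains B where "finite B" "fun_space.span B = U"
proof -
  obtain B where B: "B \<subseteq> U" "fun_space.independent B" "U \<subseteq> fun_space.span B"
    using fun_space.maximal_independent_subset by blast
  have sp: "fun_space.span B = U" using B fun_space.span_minimal[OF B(1) U] by blast
  define r where "r = (\<lambda>(f :: 'b \<Rightarrow> complex) x. if x \<in> X then f x else 0)"
  interpret r: Vector_Spaces.linear "\<lambda>(c::complex) (f::'b \<Rightarrow> complex) x. c * f x"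
    "\<lambda>(c::complex) (f::'b \<Rightarrow> complex) x. c * f x" r
    by (rule linear_funI) (auto simp: r_def)
  have inj: "inj_on r (fun_space.span B)"
    unfolding r.inj_on_iff_eq_0[OF fun_space.subspace_span]
  proof (intro ballI impI)
    fix f assume "f \<in> fun_space.span B" "r f = 0"
    then show "f = 0" using det[of f] sp by (auto simp: r_def fun_eq_iff zero_fun_def split: if_splits)
  qed
  have ind: "fun_space.independent (r ` B)" using r.independent_injective_image[OF B(2) inj] .
  define E where "E = (\<lambda>x y. if y = x then 1 else (0::complex)) ` X"
  have "r f \<in> fun_space.span E" for f
  proof -
    have "r f = (\<Sum>x\<in>X. (\<lambda>y. f x * (if y = x then 1 else 0)))"
    proof
      fix y
      have "(\<Sum>x\<in>X. (\<lambda>y. f x * (if y = x then 1 else 0))) y = (\<Sum>x\<in>X. f x * (if y = x then 1 else 0))"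
        by (induction X rule: infinite_finite_induct) auto
      also have "\<dots> = r f y" using X by (auto simp: r_def if_distrib cong: if_cong)
      finally show "r f y = (\<Sum>x\<in>X. (\<lambda>y. f x * (if y = x then 1 else 0))) y" ..
    qed
    also have "\<dots> \<in> fun_space.span E"
      by (intro fun_space.span_sum fun_space.span_scale fun_space.span_base) (auto simp: E_def)
    finally show ?thesis .
  qed
  then have "finite (r ` B)" using fun_space.independent_span_bound[OF _ ind, of E] X E_def by blast
  then have "finite B" by (rule finite_imageD) (rule inj_on_subset[OF inj fun_space.span_superset])
  with sp that show thesis by blast
qed

lemma surj_if_inj_finite_span:
  fixes B :: "('b \<Rightarrow> complex) set"
  assumes B: "finite B"
    and S: "Vector_Spaces.linear (\<lambda>c f x. c * f x) (\<lambda>c f x. c * f x) S"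
    and cl: "\<And>f. f \<in> fun_space.span B \<Longrightarrow> S f \<in> fun_space.span B"
    and inj: "\<And>f. f \<in> fun_space.span B \<Longrightarrow> S f = 0 \<Longrightarrow> f = 0"
    and g: "g \<in> fun_space.span B"
  shows "\<exists>f\<in>fun_space.span B. S f = g"
proof -
  interpret S: Vector_Spaces.linear "\<lambda>(c::complex) (f::'b \<Rightarrow> complex) x. c * f x"
    "\<lambda>(c::complex) (f::'b \<Rightarrow> complex) x. c * f x" S by (rule S)
  obtain C where C: "C \<subseteq> fun_space.span B" "fun_space.independent C" "fun_space.span B \<subseteq> fun_space.span C"
    using fun_space.maximal_independent_subset by blast
  have sp: "fun_space.span C = fun_space.span B"
    using C fun_space.span_minimal[OF C(1) fun_space.subspace_span] by blast
  have fC: "finite C" using fun_space.independent_span_bound[OF B C(2)] C(1) by blast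
  have iS: "inj_on S (fun_space.span C)"
    unfolding S.inj_on_iff_eq_0[OF fun_space.subspace_span] using inj sp by blast
  have ind: "fun_space.independent (S ` C)" using S.independent_injective_image[OF C(2) iS] .
  have card: "card (S ` C) = card C"
    by (rule card_image) (rule inj_on_subset[OF iS fun_space.span_superset])
  have "g \<in> fun_space.span (S ` C)"
  proof (rule ccontr)
    assume n: "g \<notin> fun_space.span (S ` C)"
    then have "fun_space.independent (insert g (S ` C))" using ind by (rule fun_space.independent_insertI)
    moreover have "insert g (S ` C) \<subseteq> fun_space.span C" using g C cl sp by blast
    ultimately have "card (insert g (S ` C)) \<le> card C"
      using fun_space.independent_span_bound[OF fC] by blast
    moreover have "g \<notin> S ` C" using n fun_space.span_base by blast
    ultimately show False using fC card by simp
  qed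
  then show ?thesis unfolding S.span_image sp by blast
qed

section \<open>Eigenvalue one on a layer and twisted conjugacy\<close>

context group
begin

text \<open>
  The transpose of \<open>\<phi> - 1\<close> is onto on the dual of layer \<open>k\<close>, i.e. on functions in \<open>poly_funs (Suc k)\<close> restricted
  to \<open>dim_subgroup k\<close>, modulo constants. By finite dimension this says that \<open>\<phi>\<close> does not have the eigenvalue
  one on layer \<open>k\<close>; the surjective form is what the descent through the layers uses.
\<close>

definition layer_onto :: "('a \<Rightarrow> 'a) \<Rightarrow> nat \<Rightarrow> bool" where
  "layer_onto \<phi> k \<longleftrightarrow> (\<forall>f\<in>poly_funs (Suc k). \<exists>f'\<in>poly_funs (Suc k).
     \<forall>x\<in>dim_subgroup k. f' (\<phi> x) - f' x = f x - f \<one>)"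

lemma poly_funs_subspace: "fun_space.subspace (poly_funs k)"
  by (rule fun_space.subspaceI)
    (use poly_funs_zero poly_funs_add poly_funs_scale in \<open>auto simp: zero_fun_def plus_fun_def\<close>)

text \<open>
  On a finite-dimensional space an endomorphism that is not onto has a kernel. It is applied to the space of
  the functions \<open>f - f \<one>\<close> cut off outside \<open>dim_subgroup k\<close>, which realizes the quotient by the constants.
\<close>

lemma invariant_if_not_layer_onto:
  assumes S: "finite S" "generate G S = carrier G" "S \<subseteq> carrier G"
    and \<phi>: "\<phi> \<in> hom G G" and n: "\<not> layer_onto \<phi> k"
  obtains f a where "f \<in> poly_funs (Suc k)" "a \<in> dim_subgroup k" "f a \<noteq> f \<one>"
    "\<And>x. x \<in> dim_subgroup k \<Longrightarrow> f (\<phi> x) = f x"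
proof -
  note ex = that
  show thesis
  proof (rule ccontr)
    assume no: "\<not> thesis"
    have const: "f x = f \<one>"
      if "f \<in> poly_funs (Suc k)" "\<And>x. x \<in> dim_subgroup k \<Longrightarrow> f (\<phi> x) = f x" "x \<in> dim_subgroup k" for f x
      using no ex[of f x] that by blast
    obtain X where X: "finite X" "\<And>f. f \<in> poly_funs (Suc k) \<Longrightarrow> \<forall>x\<in>X. f x = 0 \<Longrightarrow> f = (\<lambda>_. 0)"
      using poly_funs_determined[OF S, of "Suc k"] by auto
    obtain B where B: "finite B" "fun_space.span B = poly_funs (Suc k)"
      using finite_span_if_determined[OF poly_funs_subspace X] by metis
    define p where "p = (\<lambda>(f :: 'a \<Rightarrow> complex) x. if x \<in> dim_subgroup k then f x - f \<one> else 0)"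
    define T where "T = (\<lambda>(h :: 'a \<Rightarrow> complex) x. if x \<in> dim_subgroup k then h (\<phi> x) - h x else 0)"
    have lp: "Vector_Spaces.linear (\<lambda>c f x. c * f x) (\<lambda>c f x. c * f x) p"
      by (rule linear_funI) (auto simp: p_def algebra_simps)
    have lT: "Vector_Spaces.linear (\<lambda>c f x. c * f x) (\<lambda>c f x. c * f x) T"
      by (rule linear_funI) (auto simp: T_def algebra_simps)
    interpret p: Vector_Spaces.linear "\<lambda>(c::complex) (f::'a \<Rightarrow> complex) x. c * f x"
      "\<lambda>(c::complex) (f::'a \<Rightarrow> complex) x. c * f x" p by (rule lp)
    have sp: "fun_space.span (p ` B) = p ` poly_funs (Suc k)" by (simp add: p.span_image B)
    have \<phi>D: "\<phi> x \<in> dim_subgroup k" if "x \<in> dim_subgroup k" for x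
      using dim_subgroup_hom[OF \<phi> that] .
    have \<phi>1: "\<phi> \<one> = \<one>" using hom_one[OF \<phi> is_group is_group] .
    have Tp: "T (p f) = p (\<lambda>x. pull \<phi> f x - f x)" for f
      by (rule ext) (simp add: T_def p_def \<phi>D pull_def dim_subgroup_carrier \<phi>1)
    have "\<exists>f'\<in>poly_funs (Suc k). \<forall>x\<in>dim_subgroup k. f' (\<phi> x) - f' x = f x - f \<one>"
      if f: "f \<in> poly_funs (Suc k)" for f
    proof -
      have "\<exists>h\<in>fun_space.span (p ` B). T h = p f"
      proof (rule surj_if_inj_finite_span[OF _ lT])
        show "finite (p ` B)" using B by simp
        show "p f \<in> fun_space.span (p ` B)" using f sp by blast
        show "T h \<in> fun_space.span (p ` B)" if h: "h \<in> fun_space.span (p ` B)" for h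
        proof -
          obtain f where f: "f \<in> poly_funs (Suc k)" "h = p f" using h unfolding sp by blast
          then show ?thesis unfolding sp f Tp using poly_funs_diff[OF pull_hom[OF \<phi> f(1)] f(1)] by blast
        qed
        show "h = 0" if h: "h \<in> fun_space.span (p ` B)" and z: "T h = 0" for h
        proof -
          obtain f where f: "f \<in> poly_funs (Suc k)" "h = p f" using h unfolding sp by blast
          have "f (\<phi> x) = f x" if "x \<in> dim_subgroup k" for x
            using fun_cong[OF z, of x] that by (simp add: f T_def p_def \<phi>D)
          from const[OF f(1) this] show ?thesis by (auto simp: f p_def fun_eq_iff)
        qed
      qed
      then obtain f' where f': "f' \<in> poly_funs (Suc k)" "T (p f') = p f" unfolding sp by blast
      have "f' (\<phi> x) - f' x = f x - f \<one>" if "x \<in> dim_subgroup k" for x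
        using fun_cong[OF f'(2), of x] that by (simp add: T_def p_def \<phi>D)
      with f'(1) show ?thesis by blast
    qed
    with n show False unfolding layer_onto_def by blast
  qed
qed

lemma dim_subgroup_1: "dim_subgroup (Suc 0) = carrier G"
proof -
  have "f g = f \<one>" if f: "f \<in> poly_funs (Suc 0)" and g: "g \<in> carrier G" for f g
    using fun_cong[OF poly_funs_0D[OF right_difference[OF f g]], of \<one>] g by (simp add: pull_def)
  then show ?thesis unfolding dim_subgroup_def by blast
qed

lemma dim_subgroup_0: "dim_subgroup 0 = carrier G"
  by (simp add: dim_subgroup_def poly_funs.simps)

lemma dim_subgroup_antimono_le: "i \<le> j \<Longrightarrow> d \<in> dim_subgroup j \<Longrightarrow> d \<in> dim_subgroup i"
  by (induction rule: inc_induct) (auto intro: dim_subgroup_antimono)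

text \<open>
  For the first layer \<open>c\<close> that is not onto, take an invariant \<open>f\<close> with \<open>f a \<noteq> f \<one>\<close>; the powers of \<open>a\<close> lie in
  different classes. A conjugating element \<open>g\<close> satisfies \<open>h (\<phi> g) = h g\<close> for all functions \<open>h\<close> of the degree that
  belongs to the layer reached so far, and since \<open>\<phi> - 1\<close> is onto there, \<open>g\<close> lies in the next dimension
  subgroup. Once \<open>g\<close> has reached layer \<open>c\<close>, additivity and invariance of \<open>f\<close> recover the exponents.
\<close>

lemma infinite_reidemeister_if_not_layer_onto:
  assumes S: "finite S" "generate G S = carrier G" "S \<subseteq> carrier G"
    and \<phi>: "\<phi> \<in> hom G G" and n: "\<not> layer_onto \<phi> k"
  shows "reidemeister_number G \<phi> = \<infinity>"
proof -
  define c where "c = (LEAST k. \<not> layer_onto \<phi> k)"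
  have c: "\<not> layer_onto \<phi> c" unfolding c_def using n by (rule LeastI)
  have below: "layer_onto \<phi> i" if "i < c" for i using that not_less_Least unfolding c_def by blast
  obtain f a where f: "f \<in> poly_funs (Suc c)" and a: "a \<in> dim_subgroup c" "f a \<noteq> f \<one>"
    and inv: "\<And>x. x \<in> dim_subgroup c \<Longrightarrow> f (\<phi> x) = f x"
    using invariant_if_not_layer_onto[OF S \<phi> c] by blast
  have ac: "a \<in> carrier G" using a dim_subgroup_carrier by blast
  have inj: "r = s" if g: "g \<in> carrier G" and eq: "a [^] r \<otimes> \<phi> g = g \<otimes> a [^] s" for g and r s :: nat
  proof -
    have \<phi>g: "\<phi> g \<in> carrier G" using hom_in_carrier[OF \<phi> g] .
    (* Descent of the conjugating element through the layers below c. *)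
    have "i \<le> c \<Longrightarrow> g \<in> dim_subgroup i" for i
    proof (induction i)
      case 0
      then show ?case using g by (simp add: dim_subgroup_0)
    next
      case (Suc i)
      then have gi: "g \<in> dim_subgroup i" by simp
      have pow: "a [^] m \<in> dim_subgroup (Suc i)" for m :: nat
        using dim_subgroup_antimono_le[OF Suc.prems dim_subgroup_pow[OF a(1)]] .
      have "h g = h \<one>" if h: "h \<in> poly_funs (Suc i)" for h
      proof -
        have "layer_onto \<phi> i" using below Suc.prems by simp
        then obtain h' where h': "h' \<in> poly_funs (Suc i)" "h' (\<phi> g) - h' g = h g - h \<one>"
          using h gi unfolding layer_onto_def by blast
        have p1: "h' (a [^] m) = h' \<one>" for m :: nat using dim_subgroupD[OF pow h'(1)] .
        have "h' (a [^] r \<otimes> \<phi> g) = h' (\<phi> g)"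
          using poly_fun_mult_left[OF h'(1) dim_subgroup_antimono[OF pow] \<phi>g] p1 by simp
        moreover have "h' (g \<otimes> a [^] s) = h' g"
          using poly_fun_mult_right[OF h'(1) dim_subgroup_antimono[OF pow] g] p1 by simp
        ultimately show ?thesis using eq h'(2) by simp
      qed
      then show ?case using g by (simp add: dim_subgroup_def)
    qed
    then have gc: "g \<in> dim_subgroup c" by blast
    have "f (a [^] r) + f (\<phi> g) = f g + f (a [^] s)"
      using poly_fun_mult_left[OF f dim_subgroup_pow[OF a(1)] \<phi>g, of r]
        poly_fun_mult_right[OF f dim_subgroup_pow[OF a(1)] g, of s] eq by (simp add: algebra_simps)
    then have "f (a [^] r) - f \<one> = f (a [^] s) - f \<one>" using inv[OF gc] by simp
    then show "r = s" using a(2) by (simp add: poly_fun_pow[OF f a(1)])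
  qed
  have "inj (\<lambda>r::nat. twisted_conj G \<phi> `` {a [^] r})"
  proof (rule injI)
    fix r s :: nat
    assume e: "twisted_conj G \<phi> `` {a [^] r} = twisted_conj G \<phi> `` {a [^] s}"
    have "(a [^] s, a [^] s) \<in> twisted_conj G \<phi>"
    proof -
      have "a [^] s = \<one> \<otimes> a [^] s \<otimes> inv (\<phi> \<one>)" using ac hom_one[OF \<phi> is_group is_group] by simp
      with ac show ?thesis unfolding twisted_conj_def by blast
    qed
    then have "(a [^] r, a [^] s) \<in> twisted_conj G \<phi>" using e by blast
    then obtain g where g: "g \<in> carrier G" "a [^] r = g \<otimes> a [^] s \<otimes> inv (\<phi> g)"
      unfolding twisted_conj_def by blast
    have \<phi>g: "\<phi> g \<in> carrier G" using hom_in_carrier[OF \<phi> g(1)] .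
    have "a [^] r \<otimes> \<phi> g = g \<otimes> a [^] s" unfolding g(2) using g(1) \<phi>g ac by (simp add: m_assoc)
    with inj g(1) show "r = s" by blast
  qed
  moreover have "range (\<lambda>r::nat. twisted_conj G \<phi> `` {a [^] r}) \<subseteq> carrier G // twisted_conj G \<phi>"
    using ac by (auto simp: quotient_def)
  ultimately have "infinite (carrier G // twisted_conj G \<phi>)"
    by (meson finite_subset infinite_UNIV_nat finite_imageD)
  then show ?thesis by (simp add: reidemeister_number_def)
qed

end

section \<open>Iterated brackets of generalized eigenvectors\<close>

text \<open>
  A finitely generated group with exponent sums: \<open>expo i\<close> counts the generator \<open>gen i\<close>. Equivalently, the
  abelianization is free abelian on the images of the generators.
\<close>

locale marked_group = group G for G (structure) +
  fixes n :: nat and gen :: "nat \<Rightarrow> 'a" and expo :: "nat \<Rightarrow> 'a \<Rightarrow> int"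
  assumes gen_closed: "i < n \<Longrightarrow> gen i \<in> carrier G"
    and generate_gen: "generate G (gen ` {..<n}) = carrier G"
    and expo_mult: "x \<in> carrier G \<Longrightarrow> y \<in> carrier G \<Longrightarrow> expo i (x \<otimes> y) = expo i x + expo i y"
    and expo_gen: "i < n \<Longrightarrow> j < n \<Longrightarrow> expo i (gen j) = (if i = j then 1 else 0)"
begin

lemma expo_one: "expo i \<one> = 0"
  using expo_mult[of \<one> \<one> i] by simp

lemma expo_inv: "x \<in> carrier G \<Longrightarrow> expo i (inv x) = - expo i x"
  using expo_mult[of x "inv x" i] by (simp add: expo_one)

text \<open>
  A map that is additive modulo a subspace \<open>U\<close> is determined modulo \<open>U\<close> by its values on the generators. The
  subspace is needed because \<open>bracket_diff\<close> is additive only up to lower order.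
\<close>

lemma additive_mod_expand:
  fixes A :: "'a \<Rightarrow> 'c \<Rightarrow> complex"
  assumes zero: "(\<lambda>_. 0) \<in> U"
    and add: "\<And>f g. f \<in> U \<Longrightarrow> g \<in> U \<Longrightarrow> (\<lambda>x. f x + g x) \<in> U"
    and scale: "\<And>c f. f \<in> U \<Longrightarrow> (\<lambda>x. c * f x) \<in> U"
    and A: "\<And>g h. g \<in> carrier G \<Longrightarrow> h \<in> carrier G \<Longrightarrow> (\<lambda>x. A (g \<otimes> h) x - A g x - A h x) \<in> U"
    and g: "g \<in> carrier G"
  shows "(\<lambda>x. A g x - (\<Sum>i<n. of_int (expo i g) * A (gen i) x)) \<in> U"
proof -
  have gc: "h \<in> carrier G" if "h \<in> generate G (gen ` {..<n})" for h
    using that generate_gen by blast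
  have A1: "A \<one> \<in> U" using scale[OF A[of \<one> \<one>], of "-1"] by simp
  have A_gen: "(\<lambda>x. A (gen j) x - (\<Sum>i<n. of_int (expo i (gen j)) * A (gen i) x)) = (\<lambda>_. 0)" if "j < n" for j
  proof
    fix x
    have "(\<Sum>i<n. of_int (expo i (gen j)) * A (gen i) x) = (\<Sum>i<n. if i = j then A (gen j) x else 0)"
      using that by (intro sum.cong) (auto simp: expo_gen)
    then show "A (gen j) x - (\<Sum>i<n. of_int (expo i (gen j)) * A (gen i) x) = 0" using that by simp
  qed
  have "g \<in> generate G (gen ` {..<n})" using g generate_gen by simp
  then show ?thesis
  proof induction
    case one
    then show ?case using A1 by (simp add: expo_one)
  next
    case (incl h)
    then show ?case using A_gen zero by auto
  next
    case (inv h)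
    then obtain j where j: "j < n" "h = gen j" by blast
    have h: "h \<in> carrier G" using j gen_closed by simp
    have "(\<lambda>x. -1 * (A (h \<otimes> inv h) x - A h x - A (inv h) x) + A \<one> x) \<in> U"
      by (intro add scale A A1 h inv_closed)
    then show ?case
    proof (rule back_subst[of "\<lambda>f. f \<in> U"], intro ext)
      fix x
      have "A h x = (\<Sum>i<n. of_int (expo i h) * A (gen i) x)"
        using fun_cong[OF A_gen[OF j(1)], of x] j(2) by simp
      then show "-1 * (A (h \<otimes> inv h) x - A h x - A (inv h) x) + A \<one> x =
          A (inv h) x - (\<Sum>i<n. of_int (expo i (inv h)) * A (gen i) x)"
        using h by (simp add: expo_inv sum_negf)
    qed
  next
    case (eng h1 h2)
    note h = gc[OF eng.hyps(1)] gc[OF eng.hyps(2)]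
    show ?case
      by (rule back_subst[of "\<lambda>f. f \<in> U", OF add[OF add[OF eng.IH] A[OF h]]])
        (simp add: expo_mult h fun_eq_iff ring_distribs sum.distrib)
  qed
qed

lemma additive_expand:
  fixes A :: "'a \<Rightarrow> complex"
  assumes A: "\<And>g h. g \<in> carrier G \<Longrightarrow> h \<in> carrier G \<Longrightarrow> A (g \<otimes> h) = A g + A h"
    and g: "g \<in> carrier G"
  shows "A g = (\<Sum>i<n. of_int (expo i g) * A (gen i))"
  using additive_mod_expand[where U = "{\<lambda>_::unit. 0::complex}" and A = "\<lambda>g _. A g" and g = g] A g
  by (simp add: fun_eq_iff)

definition action_matrix :: "('a \<Rightarrow> 'a) \<Rightarrow> nat \<Rightarrow> nat \<Rightarrow> complex" where
  "action_matrix \<phi> i j = of_int (expo i (\<phi> (gen j)))"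

lemma det_action_matrix:
  assumes \<phi>: "\<phi> \<in> iso G G"
  shows "(Determinant.det (mat n n (\<lambda>(i,j). action_matrix \<phi> i j)))\<^sup>2 = 1"
proof -
  let ?\<psi> = "inv_into (carrier G) \<phi>"
  have \<psi>: "?\<psi> \<in> hom G G" using iso_set_sym[OF \<phi>] by (simp add: iso_def)
  have \<phi>h: "\<phi> \<in> hom G G" and b: "bij_betw \<phi> (carrier G) (carrier G)" using \<phi> by (auto simp: iso_def)
  have "(\<Sum>j<n. expo i (?\<psi> (gen j)) * expo j (\<phi> (gen k))) = (if i = k then 1 else 0)"
    if "i < n" "k < n" for i k
  proof -
    have "complex_of_int (expo i (?\<psi> (\<phi> (gen k)))) =
        (\<Sum>j<n. of_int (expo j (\<phi> (gen k))) * of_int (expo i (?\<psi> (gen j))))"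
      by (rule additive_expand)
        (simp_all add: hom_mult[OF \<psi>] expo_mult hom_in_carrier[OF \<psi>] hom_in_carrier[OF \<phi>h] gen_closed that)
    also have "\<dots> = of_int (\<Sum>j<n. expo i (?\<psi> (gen j)) * expo j (\<phi> (gen k)))"
      by (simp add: mult.commute)
    finally have "expo i (?\<psi> (\<phi> (gen k))) = (\<Sum>j<n. expo i (?\<psi> (gen j)) * expo j (\<phi> (gen k)))"
      by (simp only: of_int_eq_iff)
    moreover have "?\<psi> (\<phi> (gen k)) = gen k" using b gen_closed[OF that(2)] by (simp add: bij_betw_def)
    ultimately show ?thesis using expo_gen[OF that] by simp
  qed
  from det_square_eq_1_if_int_inverse[OF this] show ?thesis by (simp add: action_matrix_def)
qed

text \<open>
  The dual of the Lie bracket with the complex vector \<open>u\<close> of the first layer.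
\<close>

definition bracket_by :: "(nat \<Rightarrow> complex) \<Rightarrow> ('a \<Rightarrow> complex) \<Rightarrow> 'a \<Rightarrow> complex" where
  "bracket_by u f = (\<lambda>x. \<Sum>v<n. u v * bracket_diff (gen v) f x)"

lemma bracket_by_linear:
  "bracket_by u (\<lambda>x. f x + g x) = (\<lambda>x. bracket_by u f x + bracket_by u g x)"
  "bracket_by u (\<lambda>x. f x - g x) = (\<lambda>x. bracket_by u f x - bracket_by u g x)"
  "bracket_by u (\<lambda>x. c * f x) = (\<lambda>x. c * bracket_by u f x)"
proof -
  have *: "bracket_diff h (\<lambda>x. f x + g x) x = bracket_diff h f x + bracket_diff h g x"
    "bracket_diff h (\<lambda>x. f x - g x) x = bracket_diff h f x - bracket_diff h g x"
    "bracket_diff h (\<lambda>x. c * f x) x = c * bracket_diff h f x" for h x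
    by (auto simp: bracket_diff_def algebra_simps)
  show "bracket_by u (\<lambda>x. f x + g x) = (\<lambda>x. bracket_by u f x + bracket_by u g x)"
    by (simp add: bracket_by_def * distrib_left sum.distrib)
  show "bracket_by u (\<lambda>x. f x - g x) = (\<lambda>x. bracket_by u f x - bracket_by u g x)"
    by (simp add: bracket_by_def * right_diff_distrib sum_subtractf)
  show "bracket_by u (\<lambda>x. c * f x) = (\<lambda>x. c * bracket_by u f x)"
    by (simp add: bracket_by_def * sum_distrib_left mult.left_commute)
qed

lemma bracket_by_shifted_op:
  "bracket_by (shifted_op n M l u) f x = bracket_by (mat_op n M u) f x - l * bracket_by u f x"
  by (simp add: bracket_by_def shifted_op_def left_diff_distrib sum_subtractf sum_distrib_left mult.assoc)

lemma mat_op_sum: "(\<Sum>i<n. mat_op n M u i * a i) = (\<Sum>v<n. u v * (\<Sum>i<n. M i v * (a i :: complex)))"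
proof -
  have "(\<Sum>i<n. mat_op n M u i * a i) = (\<Sum>i<n. \<Sum>v<n. u v * (M i v * a i))"
    by (rule sum.cong) (simp_all add: mat_op_def sum_distrib_right mult.assoc mult.left_commute)
  also have "\<dots> = (\<Sum>v<n. u v * (\<Sum>i<n. M i v * a i))"
    unfolding sum_distrib_left by (rule sum.swap)
  finally show ?thesis .
qed

lemma bracket_by_poly_funs: "f \<in> poly_funs (Suc k) \<Longrightarrow> bracket_by u f \<in> poly_funs k"
  unfolding bracket_by_def
  by (intro poly_funs_sum poly_funs_scale bracket_diff_poly_funs) (auto simp: gen_closed)

lemma bracket_by_const:
  assumes "f \<in> poly_funs (Suc (Suc k))" "\<And>x. x \<in> dim_subgroup (Suc k) \<Longrightarrow> f x = f \<one>" "d \<in> dim_subgroup k"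
  shows "bracket_by u f d = 0"
  unfolding bracket_by_def using bracket_diff_const[OF assms(1,2) gen_closed assms(3)] by simp

text \<open>
  Equivariance of the bracket, \<open>\<phi> [x, u] = [\<phi> x, \<phi> u]\<close>, in dual form; it holds in the graded ring only, hence up to
  lower order.
\<close>

lemma bracket_by_pull:
  assumes \<phi>: "\<phi> \<in> hom G G" and f: "f \<in> poly_funs (Suc (Suc k))"
  shows "(\<lambda>x. bracket_by u (pull \<phi> f) x
     - pull \<phi> (bracket_by (mat_op n (action_matrix \<phi>) u) f) x) \<in> poly_funs k"
proof -
  let ?M = "action_matrix \<phi>"
  have E: "(\<lambda>x. bracket_diff (\<phi> (gen v)) f x - (\<Sum>i<n. ?M i v * bracket_diff (gen i) f x)) \<in> poly_funs k"
    if "v < n" for v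
    unfolding action_matrix_def
    by (rule additive_mod_expand[where A = "\<lambda>g. bracket_diff g f", OF poly_funs_zero poly_funs_add
        poly_funs_scale bracket_diff_mult[OF f] hom_in_carrier[OF \<phi> gen_closed[OF that]]])
  have "pull \<phi> (\<lambda>x. \<Sum>v<n. u v * (bracket_diff (\<phi> (gen v)) f x - (\<Sum>i<n. ?M i v * bracket_diff (gen i) f x)))
      \<in> poly_funs k"
    by (intro pull_hom[OF \<phi>] poly_funs_sum poly_funs_scale E) auto
  then show ?thesis
  proof (rule back_subst[of "\<lambda>f. f \<in> poly_funs k"], intro ext)
    fix x
    show "pull \<phi> (\<lambda>x. \<Sum>v<n. u v * (bracket_diff (\<phi> (gen v)) f x - (\<Sum>i<n. ?M i v * bracket_diff (gen i) f x))) x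
      = bracket_by u (pull \<phi> f) x - pull \<phi> (bracket_by (mat_op n ?M u) f) x"
    proof (cases "x \<in> carrier G")
      case True
      have "bracket_diff (gen v) (pull \<phi> f) x = bracket_diff (\<phi> (gen v)) f (\<phi> x)" if "v < n" for v
        using that True gen_closed[OF that]
        by (simp add: bracket_diff_def pull_def hom_mult[OF \<phi>] hom_in_carrier[OF \<phi>])
      then show ?thesis
        using True by (simp add: bracket_by_def pull_def right_diff_distrib sum_subtractf mat_op_sum)
    qed (simp add: pull_def bracket_by_def bracket_diff_def)
  qed
qed

definition eig_op :: "('a \<Rightarrow> 'a) \<Rightarrow> complex \<Rightarrow> ('a \<Rightarrow> complex) \<Rightarrow> 'a \<Rightarrow> complex" where
  "eig_op \<phi> m f = (\<lambda>x. pull \<phi> f x - m * f x)"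

text \<open>
  The elements of layer \<open>k\<close>, tensored with the complex numbers, as functionals on the dual of the layer. A
  functional is defined on all functions, so it has to vanish on those that are trivial on the layer.
\<close>

definition layer_functional :: "nat \<Rightarrow> (('a \<Rightarrow> complex) \<Rightarrow> complex) \<Rightarrow> bool" where
  "layer_functional k t \<longleftrightarrow> (\<forall>f g. t (\<lambda>x. f x + g x) = t f + t g) \<and> (\<forall>c f. t (\<lambda>x. c * f x) = c * t f) \<and>
     (\<forall>f\<in>poly_funs (Suc k). (\<forall>x\<in>dim_subgroup k. f x = f \<one>) \<longrightarrow> t f = 0)"

text \<open>
  For a functional \<open>t\<close> on layer \<open>k\<close>: as a vector of the complexified layer, \<open>t\<close> lies in the generalized
  eigenspace of \<open>\<phi>\<close> for \<open>m\<close>.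
\<close>

definition killed_by :: "('a \<Rightarrow> 'a) \<Rightarrow> complex \<Rightarrow> nat \<Rightarrow> nat \<Rightarrow> (('a \<Rightarrow> complex) \<Rightarrow> complex) \<Rightarrow> bool" where
  "killed_by \<phi> m N k t \<longleftrightarrow> (\<forall>f\<in>poly_funs (Suc k). t ((eig_op \<phi> m ^^ N) f) = 0)"

lemma layer_functional_diff:
  assumes "layer_functional k t"
  shows "t (\<lambda>x. f x - g x) = t f - t g"
proof -
  have "t (\<lambda>x. f x + g x) = t f + t g" and "t (\<lambda>x. c * f x) = c * t f" for f g c
    using assms unfolding layer_functional_def by auto
  from this(1)[of f "\<lambda>x. - 1 * g x"] this(2)[of "- 1" g] show ?thesis by simp
qed

lemma layer_functional_lower:
  assumes "layer_functional k t" "f \<in> poly_funs k"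
  shows "t f = 0"
  using assms poly_funs_Suc dim_subgroupD unfolding layer_functional_def by blast

lemma eig_op_poly_funs: "\<phi> \<in> hom G G \<Longrightarrow> f \<in> poly_funs k \<Longrightarrow> eig_op \<phi> m f \<in> poly_funs k"
  unfolding eig_op_def by (intro poly_funs_diff poly_funs_scale pull_hom)

lemma eig_op_pow_poly_funs: "\<phi> \<in> hom G G \<Longrightarrow> f \<in> poly_funs k \<Longrightarrow> (eig_op \<phi> m ^^ N) f \<in> poly_funs k"
  by (induction N) (auto intro: eig_op_poly_funs)

lemma eig_op_pow_pull:
  assumes "\<phi> \<in> hom G G"
  shows "pull \<phi> ((eig_op \<phi> m ^^ N) f) = (eig_op \<phi> m ^^ N) (pull \<phi> f)"
proof (induction N)
  case (Suc N)
  have "pull \<phi> (eig_op \<phi> m h) = eig_op \<phi> m (pull \<phi> h)" for h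
    by (rule ext) (simp add: eig_op_def pull_def hom_in_carrier[OF assms])
  then show ?case using Suc by simp
qed simp

lemma layer_functional_pull:
  assumes "layer_functional k t" "\<phi> \<in> hom G G"
  shows "layer_functional k (\<lambda>f. t (pull \<phi> f))"
proof -
  have "t (pull \<phi> f) = 0" if "f \<in> poly_funs (Suc k)" "\<forall>x\<in>dim_subgroup k. f x = f \<one>" for f
  proof -
    have "\<forall>x\<in>dim_subgroup k. pull \<phi> f x = pull \<phi> f \<one>"
      using that(2) dim_subgroup_hom[OF assms(2)] dim_subgroup_carrier hom_one[OF assms(2) is_group is_group]
      by (simp add: pull_def)
    then show ?thesis using assms(1) pull_hom[OF assms(2) that(1)] unfolding layer_functional_def by blast
  qed
  moreover have "pull \<phi> (\<lambda>x. f x + g x) = (\<lambda>x. pull \<phi> f x + pull \<phi> g x)"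
    "pull \<phi> (\<lambda>x. c * f x) = (\<lambda>x. c * pull \<phi> f x)" for f g c
    by (auto simp: pull_def)
  ultimately show ?thesis using assms(1) unfolding layer_functional_def by simp
qed

lemma layer_functional_eig_op:
  assumes "layer_functional k t" "\<phi> \<in> hom G G"
  shows "layer_functional k (\<lambda>f. t (eig_op \<phi> m f))"
proof -
  have *: "t (eig_op \<phi> m f) = t (pull \<phi> f) - m * t f" for f
    unfolding eig_op_def using layer_functional_diff[OF assms(1)] assms(1)
    unfolding layer_functional_def by simp
  show ?thesis using layer_functional_pull[OF assms] assms(1)
    unfolding layer_functional_def * by (simp add: right_diff_distrib distrib_left mult.left_commute)
qed

lemma layer_functional_bracket_by:
  assumes t: "layer_functional k t"
  shows "layer_functional (Suc k) (\<lambda>f. t (bracket_by u f))"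
proof -
  have "t (bracket_by u f) = 0" if "f \<in> poly_funs (Suc (Suc k))" "\<forall>x\<in>dim_subgroup (Suc k). f x = f \<one>" for f
  proof -
    have "bracket_by u f d = 0" if "d \<in> dim_subgroup k" for d
      by (rule bracket_by_const[OF \<open>f \<in> _\<close> _ that]) (use \<open>\<forall>x\<in>_. _\<close> in blast)
    then have "\<forall>x\<in>dim_subgroup k. bracket_by u f x = bracket_by u f \<one>"
      using dim_subgroup_one by simp
    then show ?thesis using t bracket_by_poly_funs[OF that(1)] unfolding layer_functional_def by blast
  qed
  then show ?thesis using t unfolding layer_functional_def by (simp add: bracket_by_linear)
qed

text \<open>
  The bracket of generalized eigenvectors for \<open>m\<close> and \<open>l\<close> is one for \<open>l m\<close>. This follows from
  \<open>\<phi> [t, u] - l m [t, u] = [\<phi> t, (\<phi> - l) u] + l [(\<phi> - m) t, u]\<close>: in each summand one of the two nilpotency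
  orders has dropped, so their sum bounds the nilpotency order of the bracket.
\<close>

lemma killed_by_bracket_by:
  assumes \<phi>: "\<phi> \<in> hom G G"
  shows "layer_functional k t \<Longrightarrow> killed_by \<phi> m N k t \<Longrightarrow>
    (shifted_op n (action_matrix \<phi>) l ^^ K) u = (\<lambda>_. 0) \<Longrightarrow>
    killed_by \<phi> (l * m) (K + N) (Suc k) (\<lambda>f. t (bracket_by u f))"
proof (induction "K + N" arbitrary: K N t u)
  case 0
  then have "u = (\<lambda>_. 0)" by simp
  moreover have "t (\<lambda>_. 0) = 0" using layer_functional_lower[OF 0(2) poly_funs_zero] .
  ultimately show ?case by (simp add: killed_by_def bracket_by_def)
next
  case (Suc s)
  show ?case
  proof (cases "K = 0 \<or> N = 0")
    case True
    then show ?thesis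
    proof
      assume "K = 0"
      then have "u = (\<lambda>_. 0)" using Suc.prems by simp
      moreover have "t (\<lambda>_. 0) = 0" using layer_functional_lower[OF Suc.prems(1) poly_funs_zero] .
      ultimately show ?thesis by (simp add: killed_by_def bracket_by_def)
    next
      assume "N = 0"
      then have "t f = 0" if "f \<in> poly_funs (Suc k)" for f
        using Suc.prems(2) that by (simp add: killed_by_def)
      then show ?thesis
        using bracket_by_poly_funs eig_op_pow_poly_funs[OF \<phi>] unfolding killed_by_def by blast
    qed
  next
    case False
    then obtain K' N' where KN: "K = Suc K'" "N = Suc N'" by (meson not0_implies_Suc)
    let ?M = "action_matrix \<phi>"
    let ?u = "shifted_op n ?M l u"
    let ?t1 = "\<lambda>f. t (pull \<phi> f)" and ?t2 = "\<lambda>f. t (eig_op \<phi> m f)"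
    note lf = Suc.prems(1)
    have k1: "killed_by \<phi> (l * m) s (Suc k) (\<lambda>f. ?t1 (bracket_by ?u f))"
    proof -
      have s: "s = K' + N" using Suc.hyps(2) KN by simp
      show ?thesis unfolding s
      proof (rule Suc.hyps(1)[OF s])
        show "killed_by \<phi> m N k ?t1" using Suc.prems(2) pull_hom[OF \<phi>]
          unfolding killed_by_def eig_op_pow_pull[OF \<phi>] by blast
        show "(shifted_op n ?M l ^^ K') ?u = (\<lambda>_. 0)"
          using Suc.prems(3) by (simp add: KN funpow_swap1)
      qed (rule layer_functional_pull[OF lf \<phi>])
    qed
    have k2: "killed_by \<phi> (l * m) s (Suc k) (\<lambda>f. ?t2 (bracket_by u f))"
    proof -
      have s: "s = K + N'" using Suc.hyps(2) KN by simp
      show ?thesis unfolding s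
      proof (rule Suc.hyps(1)[OF s])
        show "killed_by \<phi> m N' k ?t2" using Suc.prems(2) unfolding killed_by_def KN by simp
      qed (rule layer_functional_eig_op[OF lf \<phi>] Suc.prems(3))+
    qed
    have split: "t (bracket_by u (eig_op \<phi> (l * m) f)) = ?t1 (bracket_by ?u f) + l * ?t2 (bracket_by u f)"
      if f: "f \<in> poly_funs (Suc (Suc k))" for f
    proof -
      have add: "t (\<lambda>x. f x + g x) = t f + t g" and sc: "t (\<lambda>x. c * f x) = c * t f" for f g c
        using lf unfolding layer_functional_def by auto
      let ?Mu = "mat_op n ?M u"
      let ?E = "\<lambda>x. bracket_by u (pull \<phi> f) x - pull \<phi> (bracket_by ?Mu f) x"
      have "bracket_by u (eig_op \<phi> (l * m) f) =
          (\<lambda>x. ?E x + (pull \<phi> (bracket_by ?u f) x + l * eig_op \<phi> m (bracket_by u f) x))"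
      proof
        fix x
        have "bracket_by u (eig_op \<phi> (l * m) f) x = bracket_by u (pull \<phi> f) x - l * m * bracket_by u f x"
          by (simp add: eig_op_def bracket_by_linear)
        moreover have "pull \<phi> (bracket_by ?u f) x = pull \<phi> (bracket_by ?Mu f) x - l * pull \<phi> (bracket_by u f) x"
          by (simp add: pull_def bracket_by_shifted_op)
        ultimately show "bracket_by u (eig_op \<phi> (l * m) f) x =
          ?E x + (pull \<phi> (bracket_by ?u f) x + l * eig_op \<phi> m (bracket_by u f) x)"
          by (simp add: eig_op_def algebra_simps)
      qed
      moreover have "t ?E = 0" by (rule layer_functional_lower[OF lf bracket_by_pull[OF \<phi> f]])
      ultimately show ?thesis by (simp add: add sc)
    qed
    show ?thesis unfolding killed_by_def
    proof
      fix f assume f: "f \<in> poly_funs (Suc (Suc k))"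
      let ?F = "(eig_op \<phi> (l * m) ^^ s) f"
      have "t (bracket_by u ((eig_op \<phi> (l * m) ^^ (K + N)) f)) = t (bracket_by u (eig_op \<phi> (l * m) ?F))"
        unfolding Suc.hyps(2)[symmetric] by simp
      also have "\<dots> = ?t1 (bracket_by ?u ?F) + l * ?t2 (bracket_by u ?F)"
        by (rule split[OF eig_op_pow_poly_funs[OF \<phi> f]])
      also have "\<dots> = 0" using k1 k2 f unfolding killed_by_def by simp
      finally show "t (bracket_by u ((eig_op \<phi> (l * m) ^^ (K + N)) f)) = 0" .
    qed
  qed
qed

text \<open>
  The vector \<open>u\<close> as an element of the first layer; it is the innermost entry of an iterated bracket.
\<close>

definition increment_along :: "(nat \<Rightarrow> complex) \<Rightarrow> ('a \<Rightarrow> complex) \<Rightarrow> complex" where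
  "increment_along u f = (\<Sum>v<n. u v * (f (gen v) - f \<one>))"

lemma layer_functional_increment: "layer_functional (Suc 0) (increment_along u)"
proof -
  have "increment_along u (\<lambda>x. f x + g x) = increment_along u f + increment_along u g" for f g
    unfolding increment_along_def sum.distrib[symmetric] by (rule sum.cong) (simp_all add: algebra_simps)
  moreover have "increment_along u (\<lambda>x. c * f x) = c * increment_along u f" for c f
    unfolding increment_along_def sum_distrib_left by (rule sum.cong) (simp_all add: algebra_simps)
  moreover have "increment_along u f = 0" if c: "\<forall>x\<in>dim_subgroup (Suc 0). f x = f \<one>" for f
  proof -
    have "f (gen v) = f \<one>" if "v < n" for v using c gen_closed[OF that] unfolding dim_subgroup_1 by blast
    then show ?thesis by (simp add: increment_along_def)
  qed
  ultimately show ?thesis unfolding layer_functional_def by blast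
qed

lemma increment_along_eig_op:
  assumes \<phi>: "\<phi> \<in> hom G G" and f: "f \<in> poly_funs (Suc (Suc 0))"
  shows "increment_along u (eig_op \<phi> l f) = increment_along (shifted_op n (action_matrix \<phi>) l u) f"
proof -
  let ?M = "action_matrix \<phi>" and ?A = "\<lambda>g. f g - f \<one>"
  have A: "?A (\<phi> (gen v)) = (\<Sum>i<n. ?M i v * ?A (gen i))" if "v < n" for v
    unfolding action_matrix_def
    by (rule additive_expand)
      (use poly_fun_mult_left[OF f] hom_in_carrier[OF \<phi> gen_closed[OF that]] in \<open>auto simp: dim_subgroup_1\<close>)
  have "increment_along u (eig_op \<phi> l f) = (\<Sum>v<n. u v * (?A (\<phi> (gen v)) - l * ?A (gen v)))"
    unfolding increment_along_def eig_op_def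
    by (intro sum.cong) (simp_all add: pull_def gen_closed hom_one[OF \<phi> is_group is_group] algebra_simps)
  also have "\<dots> = (\<Sum>v<n. u v * (\<Sum>i<n. ?M i v * ?A (gen i))) - (\<Sum>v<n. l * u v * ?A (gen v))"
    by (simp add: A right_diff_distrib sum_subtractf ac_simps)
  also have "(\<Sum>v<n. u v * (\<Sum>i<n. ?M i v * ?A (gen i))) = (\<Sum>i<n. mat_op n ?M u i * ?A (gen i))"
    by (rule mat_op_sum[symmetric])
  finally show ?thesis
    unfolding increment_along_def shifted_op_def
    by (simp add: left_diff_distrib sum_subtractf)
qed

lemma killed_by_increment:
  assumes \<phi>: "\<phi> \<in> hom G G"
  shows "(shifted_op n (action_matrix \<phi>) l ^^ K) u = (\<lambda>_. 0) \<Longrightarrow>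
    killed_by \<phi> l K (Suc 0) (increment_along u)"
proof (induction K arbitrary: u)
  case 0
  then show ?case by (simp add: killed_by_def increment_along_def)
next
  case (Suc K)
  then have "killed_by \<phi> l K (Suc 0) (increment_along (shifted_op n (action_matrix \<phi>) l u))"
    by (simp add: funpow_swap1)
  then show ?case
    using increment_along_eig_op[OF \<phi> eig_op_pow_poly_funs[OF \<phi>]] unfolding killed_by_def by simp
qed

text \<open>
  The head of the list is bracketed in last, i.e. the list \<open>[u\<^sub>3, u\<^sub>2, u\<^sub>1]\<close> stands for \<open>[[u\<^sub>1, u\<^sub>2], u\<^sub>3]\<close>.
  The value at the empty list is a default.
\<close>

fun lie_functional :: "(nat \<Rightarrow> complex) list \<Rightarrow> ('a \<Rightarrow> complex) \<Rightarrow> complex" where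
  "lie_functional [] f = 0"
| "lie_functional [u] f = increment_along u f"
| "lie_functional (u # v # us) f = lie_functional (v # us) (bracket_by u f)"

lemma lie_functional_killed:
  assumes \<phi>: "\<phi> \<in> hom G G"
    and ev: "\<And>j. j \<in> set js \<Longrightarrow> \<exists>K. (shifted_op n (action_matrix \<phi>) (l j) ^^ K) (u j) = (\<lambda>_. 0)"
    and "js \<noteq> []"
  shows "layer_functional (length js) (lie_functional (map u js)) \<and>
    (\<exists>N. killed_by \<phi> (\<Prod>j\<leftarrow>js. l j) N (length js) (lie_functional (map u js)))"
  using assms(2,3)
proof (induction js)
  case (Cons j js)
  obtain K where K: "(shifted_op n (action_matrix \<phi>) (l j) ^^ K) (u j) = (\<lambda>_. 0)"
    using Cons.prems(1)[of j] by auto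
  show ?case
  proof (cases "js = []")
    case True
    have "lie_functional (map u (j # js)) = increment_along (u j)" by (rule ext) (simp add: True)
    then show ?thesis using layer_functional_increment killed_by_increment[OF \<phi> K] True by auto
  next
    case False
    then have e: "lie_functional (map u (j # js)) = (\<lambda>f. lie_functional (map u js) (bracket_by (u j) f))"
      by (cases js) auto
    obtain N where "layer_functional (length js) (lie_functional (map u js))"
      "killed_by \<phi> (\<Prod>j\<leftarrow>js. l j) N (length js) (lie_functional (map u js))"
      using Cons.IH Cons.prems(1) False by auto
    from layer_functional_bracket_by[OF this(1)] killed_by_bracket_by[OF \<phi> this K] show ?thesis
      unfolding e by auto
  qed
qed simp

lemma layer_functional_eig_op_pow:
  assumes t: "layer_functional k t" and \<phi>: "\<phi> \<in> hom G G"
  shows "layer_functional k (\<lambda>f. t ((eig_op \<phi> m ^^ N) f))"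
proof (induction N)
  case (Suc N)
  show ?case using layer_functional_eig_op[OF Suc \<phi>] by (simp add: funpow_swap1)
qed (simp add: t)

text \<open>
  Where the transpose of \<open>\<phi> - 1\<close> is onto, \<open>\<phi> - 1\<close> is injective, so that the generalized eigenspace for one is
  trivial.
\<close>

lemma vanishes_if_layer_onto:
  assumes \<phi>: "\<phi> \<in> hom G G" and onto: "layer_onto \<phi> k" and t: "layer_functional k t"
  shows "killed_by \<phi> 1 N k t \<Longrightarrow> f \<in> poly_funs (Suc k) \<Longrightarrow> t f = 0"
proof (induction N arbitrary: f)
  case 0
  then show ?case by (simp add: killed_by_def)
next
  case (Suc N)
  let ?t = "\<lambda>f. t ((eig_op \<phi> 1 ^^ N) f)"
  have lf: "layer_functional k ?t" by (rule layer_functional_eig_op_pow[OF t \<phi>])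
  have "?t g = 0" if g: "g \<in> poly_funs (Suc k)" for g
  proof -
    obtain h where h: "h \<in> poly_funs (Suc k)"
      and e: "\<And>x. x \<in> dim_subgroup k \<Longrightarrow> h (\<phi> x) - h x = g x - g \<one>"
      using onto g unfolding layer_onto_def by blast
    have c: "eig_op \<phi> 1 h x - g x = - g \<one>" if "x \<in> dim_subgroup k" for x
      using e[OF that] that dim_subgroup_carrier by (simp add: eig_op_def pull_def)
    have "(\<lambda>x. eig_op \<phi> 1 h x - g x) \<in> poly_funs (Suc k)"
      by (intro poly_funs_diff eig_op_poly_funs[OF \<phi>] h g)
    then have "?t (\<lambda>x. eig_op \<phi> 1 h x - g x) = 0"
      using lf c dim_subgroup_one unfolding layer_functional_def by simp
    moreover have "?t (eig_op \<phi> 1 h) = 0"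
      using Suc.prems(1) h by (simp add: killed_by_def funpow_swap1)
    ultimately show ?thesis using layer_functional_diff[OF lf, of "eig_op \<phi> 1 h" g] by simp
  qed
  then show ?case using Suc.IH Suc.prems(2) unfolding killed_by_def by blast
qed

theorem infinite_reidemeister_if_lie_functional:
  assumes \<phi>: "\<phi> \<in> hom G G"
    and ev: "\<And>j. j \<in> set js \<Longrightarrow> \<exists>K. (shifted_op n (action_matrix \<phi>) (l j) ^^ K) (u j) = (\<lambda>_. 0)"
    and prod: "(\<Prod>j\<leftarrow>js. l j) = 1"
    and f: "f \<in> poly_funs (Suc (length js))" "lie_functional (map u js) f \<noteq> 0"
  shows "reidemeister_number G \<phi> = \<infinity>"
proof -
  have "js \<noteq> []" using f(2) by auto
  from lie_functional_killed[of \<phi> js l u, OF \<phi> ev this] prod f vanishes_if_layer_onto[OF \<phi>]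
  have "\<not> layer_onto \<phi> (length js)" by metis
  then show ?thesis
    by (rule infinite_reidemeister_if_not_layer_onto[OF _ generate_gen _ \<phi>, rotated 2])
      (auto simp: gen_closed)
qed

end

section \<open>Brackets of antidiagonal matrices\<close>

text \<open>
  A type of matrices whose multiplication is that of the type class, so that power series with matrix
  coefficients are available.
\<close>

datatype mat2 = Mat2 (m11: complex) (m12: complex) (m21: complex) (m22: complex)

instantiation mat2 :: ring_1
begin

definition zero_mat2 where "0 = Mat2 0 0 0 0"
definition one_mat2 where "1 = Mat2 1 0 0 1"
definition plus_mat2 where "A + B = Mat2 (m11 A + m11 B) (m12 A + m12 B) (m21 A + m21 B) (m22 A + m22 B)"
definition minus_mat2 where "A - B = Mat2 (m11 A - m11 B) (m12 A - m12 B) (m21 A - m21 B) (m22 A - m22 B)"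
definition uminus_mat2 where "- A = Mat2 (- m11 A) (- m12 A) (- m21 A) (- m22 A)"
definition times_mat2 where
  "A * B = Mat2 (m11 A * m11 B + m12 A * m21 B) (m11 A * m12 B + m12 A * m22 B)
     (m21 A * m11 B + m22 A * m21 B) (m21 A * m12 B + m22 A * m22 B)"

instance
  by standard
    (simp_all add: zero_mat2_def one_mat2_def plus_mat2_def minus_mat2_def uminus_mat2_def times_mat2_def
      algebra_simps mat2.expand)

end

lemmas mat2_arith = zero_mat2_def one_mat2_def plus_mat2_def minus_mat2_def uminus_mat2_def times_mat2_def

definition scalar_mat :: "complex \<Rightarrow> mat2" where
  "scalar_mat c = Mat2 c 0 0 c"

lemma scalar_mat_commute: "scalar_mat c * A = A * scalar_mat c"
  by (simp add: scalar_mat_def times_mat2_def)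

definition antidiag :: "complex \<Rightarrow> complex \<Rightarrow> mat2" where
  "antidiag p q = Mat2 0 p q 0"

lemma antidiag_sum:
  "(\<Sum>v\<in>I. scalar_mat (u v) * antidiag (p v) (q v)) = antidiag (\<Sum>v\<in>I. u v * p v) (\<Sum>v\<in>I. u v * q v)"
  by (induction I rule: infinite_finite_induct) (simp_all add: scalar_mat_def antidiag_def mat2_arith)

fun lie_bracket :: "('b \<Rightarrow> 'r::ring_1) \<Rightarrow> 'b list \<Rightarrow> 'r" where
  "lie_bracket w [] = 0"
| "lie_bracket w [u] = w u"
| "lie_bracket w (u # v # us) = lie_bracket w (v # us) * w u - w u * lie_bracket w (v # us)"

lemma lie_bracket_Cons:
  "us \<noteq> [] \<Longrightarrow> lie_bracket w (u # us) = lie_bracket w us * w u - w u * lie_bracket w us"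
  by (cases us) auto

lemma lie_bracket_map: "lie_bracket w (map f us) = lie_bracket (w \<circ> f) us"
  by (induction "w \<circ> f" us rule: lie_bracket.induct) auto

lemma fps_const_X_power_mult:
  fixes a b :: "'r::ring_1"
  shows "(fps_const a * fps_X ^ i) * (fps_const b * fps_X ^ k) = fps_const (a * b) * fps_X ^ (i + k)"
proof -
  have "(fps_const a * fps_X ^ i) * (fps_const b * fps_X ^ k) = fps_const a * (fps_X ^ i * fps_const b) * fps_X ^ k"
    by (simp only: mult.assoc)
  also have "fps_X ^ i * fps_const b = fps_const b * fps_X ^ i"
    by (rule fps_mult_fps_X_power_commute)
  finally show ?thesis by (simp only: mult.assoc power_add fps_const_mult[symmetric])
qed

lemma lie_bracket_fps_X:
  "us \<noteq> [] \<Longrightarrow> lie_bracket (\<lambda>u. fps_const (w u) * fps_X) us = fps_const (lie_bracket w us) * fps_X ^ length us"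
proof (induction us)
  case (Cons u us)
  show ?case
  proof (cases "us = []")
    case False
    let ?l = "length us" and ?A = "lie_bracket w us"
    have "lie_bracket (\<lambda>u. fps_const (w u) * fps_X) (u # us) =
        (fps_const ?A * fps_X ^ ?l) * (fps_const (w u) * fps_X ^ 1) - (fps_const (w u) * fps_X ^ 1) * (fps_const ?A * fps_X ^ ?l)"
      using Cons.IH False by (simp add: lie_bracket_Cons)
    also have "\<dots> = fps_const (?A * w u) * fps_X ^ Suc ?l - fps_const (w u * ?A) * fps_X ^ Suc ?l"
      unfolding fps_const_X_power_mult by simp
    also have "\<dots> = fps_const (lie_bracket w (u # us)) * fps_X ^ length (u # us)"
      by (simp only: lie_bracket_Cons[OF False] left_diff_distrib[symmetric] fps_const_sub length_Cons)
    finally show ?thesis .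
  qed simp
qed simp

text \<open>
  With \<open>w\<^sub>i = antidiag (p i) (q i)\<close> and \<open>H = diag(1, -1)\<close>, the bracket of \<open>w\<^sub>i\<close> and \<open>w\<^sub>j\<close> is
  \<open>(p i q j - p j q i) H\<close>, and bracketing \<open>H\<close> with \<open>w\<^sub>i\<close> and then with \<open>w\<^sub>j\<close> gives \<open>2 (p i q j + p j q i) H\<close>. So the
  bracket of an even number of entries is a multiple of \<open>H\<close>. The entries are arranged such that the indices
  \<open>j1, j2\<close> occur twice at the inner end, where only their mixed products appear, and all others occur in
  pairs.
\<close>

lemma lie_bracket_antidiag_nonzero:
  assumes c: "p j1 * q j2 \<noteq> p j2 * q j1" "p j1 * q j2 + p j2 * q j1 \<noteq> 0"
    and pq: "\<And>j. j \<in> set os \<Longrightarrow> p j * q j \<noteq> 0"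
  shows "m11 (lie_bracket (\<lambda>j. antidiag (p j) (q j)) (concat (map (\<lambda>j. [j, j]) os) @ [j1, j2, j1, j2])) \<noteq> 0"
proof -
  let ?w = "\<lambda>j. antidiag (p j) (q j)"
  have two: "(A * ?w i - ?w i * A) * ?w j - ?w j * (A * ?w i - ?w i * A) =
      Mat2 (2 * d * (p i * q j + p j * q i)) 0 0 (- (2 * d * (p i * q j + p j * q i)))"
    if "A = Mat2 d 0 0 (-d)" for A d i j
    using that by (simp add: mat2_arith antidiag_def algebra_simps)
  have "\<exists>d. d \<noteq> 0 \<and> lie_bracket ?w (concat (map (\<lambda>j. [j, j]) os) @ [j1, j2, j1, j2]) = Mat2 d 0 0 (-d)"
    using pq
  proof (induction os)
    case Nil
    have "lie_bracket ?w [j1, j2] = Mat2 (p j2 * q j1 - p j1 * q j2) 0 0 (- (p j2 * q j1 - p j1 * q j2))"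
      by (simp add: mat2_arith antidiag_def algebra_simps)
    from two[OF this, of j2 j1]
    have "lie_bracket ?w [j1, j2, j1, j2] = (let d = 2 * (p j2 * q j1 - p j1 * q j2) * (p j2 * q j1 + p j1 * q j2)
        in Mat2 d 0 0 (-d))"
      by (simp only: lie_bracket.simps Let_def)
    with c show ?case
      by (intro exI[of _ "2 * (p j2 * q j1 - p j1 * q j2) * (p j2 * q j1 + p j1 * q j2)"])
        (simp add: Let_def add.commute)
  next
    case (Cons j os)
    then obtain d where d: "d \<noteq> 0"
      "lie_bracket ?w (concat (map (\<lambda>j. [j, j]) os) @ [j1, j2, j1, j2]) = Mat2 d 0 0 (-d)" by auto
    have "lie_bracket ?w (concat (map (\<lambda>j. [j, j]) (j # os)) @ [j1, j2, j1, j2]) =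
        (let d' = 2 * d * (p j * q j + p j * q j) in Mat2 d' 0 0 (-d'))"
      unfolding Let_def two[OF d(2), symmetric] by (simp add: lie_bracket_Cons)
    moreover have "2 * d * (p j * q j + p j * q j) \<noteq> 0" using d(1) Cons.prems[of j] by simp
    ultimately show ?case unfolding Let_def by blast
  qed
  then show ?thesis by auto
qed

section \<open>Brackets in a unipotent representation\<close>

context marked_group
begin

text \<open>
  For a representation \<open>r\<close> by power series with constant term one, \<open>r h - 1\<close> is divisible by \<open>X\<close>. So each
  difference multiplies by one more factor \<open>X\<close>, and the \<open>c\<close>-th coefficient does not see more than \<open>c\<close> of them.
\<close>

lemma poly_funs_coefficient:
  fixes r :: "'a \<Rightarrow> mat2 fps"
  assumes mult: "\<And>x y. x \<in> carrier G \<Longrightarrow> y \<in> carrier G \<Longrightarrow> r (x \<otimes> y) = r x * r y"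
    and unip: "\<And>x. x \<in> carrier G \<Longrightarrow> fps_nth (r x) 0 = 1"
  shows "(\<And>i. i + k \<le> c \<Longrightarrow> fps_nth s i = 0) \<Longrightarrow>
    (\<lambda>x. if x \<in> carrier G then m11 (fps_nth (r x * s) c) else 0) \<in> poly_funs k"
proof (induction k arbitrary: s)
  case 0
  then have "fps_nth (r x * s) c = 0" for x by (simp add: fps_mult_nth)
  then show ?case by (simp add: poly_funs.simps zero_mat2_def cong: if_cong)
next
  case (Suc k)
  let ?f = "\<lambda>s x. if x \<in> carrier G then m11 (fps_nth (r x * s) c) else 0"
  show ?case
  proof (rule poly_funs_SucI)
    fix h assume h: "h \<in> carrier G"
    have "?f ((r h - 1) * s) \<in> poly_funs k"
    proof (rule Suc.IH)
      fix i assume i: "i + k \<le> c"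
      have "fps_nth (r h - 1) j * fps_nth s (i - j) = 0" if "j \<le> i" for j
        using that i unip[OF h] Suc.prems[of "i - j"] by (cases "j = 0") auto
      then show "fps_nth ((r h - 1) * s) i = 0" unfolding fps_mult_nth by (intro sum.neutral) auto
    qed
    then show "(\<lambda>x. pull (\<lambda>x. x \<otimes> h) (?f s) x - ?f s x) \<in> poly_funs k"
      by (rule back_subst[of "\<lambda>f. f \<in> _"])
        (use h in \<open>auto simp: fun_eq_iff pull_def mult algebra_simps minus_mat2_def\<close>)
  qed simp
qed

text \<open>
  If \<open>r (gen v) - 1 = z v X\<close> holds exactly, without higher terms, then iterated brackets of functions of the
  form \<open>t \<circ> r\<close> are given exactly by the iterated brackets of the linear terms: \<open>bracket_by u\<close> turns \<open>t\<close> into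
  \<open>\<lambda>a. t (a Z - Z a)\<close> with \<open>Z = Z u\<close>.
\<close>

lemma lie_functional_representation:
  fixes r :: "'a \<Rightarrow> mat2 fps"
  assumes mult: "\<And>x y. x \<in> carrier G \<Longrightarrow> y \<in> carrier G \<Longrightarrow> r (x \<otimes> y) = r x * r y"
    and one: "r \<one> = 1"
    and r_gen: "\<And>v. v < n \<Longrightarrow> r (gen v) = 1 + fps_const (z v) * fps_X"
  defines "Z \<equiv> \<lambda>u. fps_const (\<Sum>v<n. scalar_mat (u v) * z v) * fps_X"
  shows "us \<noteq> [] \<Longrightarrow> (\<And>a b. t (a + b) = t a + t b) \<Longrightarrow> (\<And>c a. t (fps_const (scalar_mat c) * a) = c * t a) \<Longrightarrow>
    lie_functional us (\<lambda>x. if x \<in> carrier G then t (r x) else 0) = (t (lie_bracket Z us) :: complex)"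
proof (induction us arbitrary: t)
  case (Cons u us)
  have sub: "t (a - b) = t a - t b" for a b using Cons.prems(2)[of "a - b" b] by simp
  have zero: "t 0 = 0" using sub[of 0 0] by simp
  have sum: "t (\<Sum>v\<in>I. F v) = (\<Sum>v\<in>I. t (F v))" for I :: "nat set" and F
    by (induction I rule: infinite_finite_induct) (simp_all add: zero Cons.prems(2))
  have fps_const_sum: "fps_const (\<Sum>v\<in>I. F v) = (\<Sum>v\<in>I. fps_const (F v))" for I :: "nat set" and F :: "nat \<Rightarrow> mat2"
    by (induction I rule: infinite_finite_induct) (simp_all flip: fps_const_add)
  have Z: "Z u = (\<Sum>v<n. fps_const (scalar_mat (u v)) * (fps_const (z v) * fps_X))"
    unfolding Z_def fps_const_sum sum_distrib_right by (simp add: mult.assoc[symmetric])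
  show ?case
  proof (cases "us = []")
    case True
    have "t (Z u) = (\<Sum>v<n. u v * t (fps_const (z v) * fps_X))"
      unfolding Z sum Cons.prems(3) ..
    then show ?thesis using True
      by (simp add: increment_along_def gen_closed r_gen one Cons.prems(2))
  next
    case False
    let ?t = "\<lambda>a. t (a * Z u - Z u * a)"
    have comm: "fps_const (scalar_mat c) * a = a * fps_const (scalar_mat c)" for c and a :: "mat2 fps"
      by (simp add: fps_eq_iff scalar_mat_commute)
    have "bracket_by u (\<lambda>x. if x \<in> carrier G then t (r x) else 0) x =
        (if x \<in> carrier G then ?t (r x) else 0)" for x
    proof (cases "x \<in> carrier G")
      case True
      have "r x * Z u - Z u * r x = (\<Sum>v<n. fps_const (scalar_mat (u v)) *
          (r x * (fps_const (z v) * fps_X) - (fps_const (z v) * fps_X) * r x))"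
        unfolding Z sum_distrib_left sum_distrib_right sum_subtractf[symmetric] right_diff_distrib
        by (intro sum.cong arg_cong2[of _ _ _ _ "(-)"] refl) (metis comm mult.assoc)+
      then have "?t (r x) = (\<Sum>v<n. u v * t (r x * (fps_const (z v) * fps_X) - (fps_const (z v) * fps_X) * r x))"
        by (simp only: sum Cons.prems(3))
      also have "\<dots> = (\<Sum>v<n. u v * (t (r (x \<otimes> gen v)) - t (r (gen v \<otimes> x))))"
        using True by (intro sum.cong) (simp_all add: mult gen_closed r_gen sub[symmetric] algebra_simps)
      finally show ?thesis using True by (simp add: bracket_by_def bracket_diff_def gen_closed)
    qed (simp add: bracket_by_def bracket_diff_def)
    then have bb: "bracket_by u (\<lambda>x. if x \<in> carrier G then t (r x) else 0) =
        (\<lambda>x. if x \<in> carrier G then ?t (r x) else 0)" by blast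
    have add': "?t (a + b) = ?t a + ?t b" for a b
      unfolding Cons.prems(2)[symmetric] by (simp add: algebra_simps)
    have scale': "?t (fps_const (scalar_mat c) * a) = c * ?t a" for c a
      unfolding Cons.prems(3)[symmetric] right_diff_distrib by (metis comm mult.assoc)
    have "lie_functional (u # us) f = lie_functional us (bracket_by u f)" for f
      using False by (cases us) auto
    then show ?thesis using Cons.IH[OF False add' scale'] False by (simp add: bb lie_bracket_Cons)
  qed
qed simp

end

section \<open>Generic weights\<close>

lemma exists_nonroot:
  fixes A :: "complex poly set"
  assumes "finite A" "0 \<notin> A"
  obtains s where "\<And>P. P \<in> A \<Longrightarrow> poly P s \<noteq> 0"
proof -
  have "finite (\<Union>P\<in>A. {s. poly P s = 0})" using assms by (auto intro!: poly_roots_finite)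
  then obtain s where "s \<notin> (\<Union>P\<in>A. {s. poly P s = 0})"
    using ex_new_if_finite[OF infinite_UNIV_char_0] by blast
  with that show thesis by blast
qed

text \<open>
  The weights are \<open>p v = s\<^sup>v\<close>, \<open>q v = s\<^sup>v\<close> on \<open>V1\<close> and \<open>p v = t s\<^sup>v\<close>, \<open>q v = 2 t s\<^sup>v\<close> elsewhere. Writing \<open>a j\<close> and
  \<open>b j\<close> for the parts of \<open>\<Sum>v. u j v s\<^sup>v\<close> inside and outside \<open>V1\<close>, the sums for \<open>p\<close> and \<open>q\<close> become \<open>a j + t b j\<close> and
  \<open>a j + 2 t b j\<close>. For all but finitely many \<open>s\<close> no pair \<open>(a j, b j)\<close> is zero. As the \<open>u j\<close> span everything and both
  \<open>V1\<close> and its complement contain an index, these pairs span the plane, whence two of them are independent.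
  Then each required condition excludes only finitely many \<open>t\<close>. The factor \<open>2\<close> makes the sums for \<open>p\<close> and
  \<open>q\<close> independent; it also keeps the last condition from failing identically when \<open>u j1\<close> lives inside and \<open>u j2\<close> outside \<open>V1\<close>,
  as it would with the factor \<open>-1\<close>.
\<close>

lemma generic_weights:
  fixes u c :: "nat \<Rightarrow> nat \<Rightarrow> complex"
  assumes dual: "\<And>i k. i < n \<Longrightarrow> k < n \<Longrightarrow> (\<Sum>j<n. c i j * u j k) = (if k = i then 1 else 0)"
    and nz: "\<And>j. j < n \<Longrightarrow> \<exists>k<n. u j k \<noteq> 0"
    and V1: "i1 < n" "i1 \<in> V1" and V2: "i2 < n" "i2 \<notin> V1"
  obtains p q :: "nat \<Rightarrow> complex" and j1 j2
  where "\<And>v w. (v \<in> V1 \<longleftrightarrow> w \<in> V1) \<Longrightarrow> p v * q w = p w * q v"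
    and "\<And>j. j < n \<Longrightarrow> (\<Sum>v<n. u j v * p v) * (\<Sum>v<n. u j v * q v) \<noteq> 0"
    and "j1 < n" "j2 < n"
    and "(\<Sum>v<n. u j1 v * p v) * (\<Sum>v<n. u j2 v * q v) \<noteq> (\<Sum>v<n. u j2 v * p v) * (\<Sum>v<n. u j1 v * q v)"
    and "(\<Sum>v<n. u j1 v * p v) * (\<Sum>v<n. u j2 v * q v) + (\<Sum>v<n. u j2 v * p v) * (\<Sum>v<n. u j1 v * q v) \<noteq> 0"
proof -
  define A where "A = (\<lambda>j. \<Sum>v<n. monom (if v \<in> V1 then u j v else 0) v)"
  define B where "B = (\<lambda>j. \<Sum>v<n. monom (if v \<notin> V1 then u j v else 0) v)"
  have "A j \<noteq> 0 \<or> B j \<noteq> 0" if j: "j < n" for j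
  proof -
    obtain k where k: "k < n" "u j k \<noteq> 0" using nz[OF j] by blast
    have "coeff (A j) k = (if k \<in> V1 then u j k else 0)" "coeff (B j) k = (if k \<notin> V1 then u j k else 0)"
      using k by (simp_all add: A_def B_def coeff_sum)
    then show ?thesis using k by (cases "k \<in> V1") auto
  qed
  note AB = this
  obtain s where s: "\<And>P. P \<in> insert [:0, 1:] ((A ` {..<n} \<union> B ` {..<n}) - {0}) \<Longrightarrow> poly P s \<noteq> 0"
    using exists_nonroot[of "insert [:0, 1:] ((A ` {..<n} \<union> B ` {..<n}) - {0})"] by auto
  have s0: "s \<noteq> 0" using s[of "[:0,1:]"] by simp
  define a where "a = (\<lambda>j. \<Sum>v<n. (if v \<in> V1 then u j v else 0) * s ^ v)"
  define b where "b = (\<lambda>j. \<Sum>v<n. (if v \<notin> V1 then u j v else 0) * s ^ v)"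
  have ab: "a j \<noteq> 0 \<or> b j \<noteq> 0" if "j < n" for j
  proof -
    have "poly (A j) s = a j" "poly (B j) s = b j"
      by (simp_all add: A_def B_def a_def b_def poly_sum poly_monom)
    then show ?thesis using AB[OF that] s[of "A j"] s[of "B j"] that by auto
  qed
  have sums: "(\<Sum>j<n. c i j * a j) = (if i \<in> V1 then s ^ i else 0)"
    "(\<Sum>j<n. c i j * b j) = (if i \<notin> V1 then s ^ i else 0)" if i: "i < n" for i
  proof -
    have sw: "(\<Sum>j<n. c i j * (\<Sum>v<n. (if R v then u j v else 0) * s ^ v)) = (if R i then s ^ i else 0)" for R
    proof -
      have "(\<Sum>j<n. c i j * (\<Sum>v<n. (if R v then u j v else 0) * s ^ v)) =
          (\<Sum>v<n. \<Sum>j<n. c i j * ((if R v then u j v else 0) * s ^ v))"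
        unfolding sum_distrib_left by (rule sum.swap)
      also have "\<dots> = (\<Sum>v<n. (if R v then s ^ v else 0) * (\<Sum>j<n. c i j * u j v))"
        unfolding sum_distrib_left by (intro sum.cong refl) auto
      also have "\<dots> = (\<Sum>v<n. if v = i then (if R i then s ^ i else 0) else 0)"
        by (rule sum.cong) (auto simp: dual[OF i])
      finally show ?thesis using i by simp
    qed
    show "(\<Sum>j<n. c i j * a j) = (if i \<in> V1 then s ^ i else 0)" unfolding a_def by (rule sw)
    show "(\<Sum>j<n. c i j * b j) = (if i \<notin> V1 then s ^ i else 0)"
      unfolding b_def by (rule sw)
  qed
  (* Otherwise the determinant of the images of the unit vectors i1 and i2, which is s^i1 * s^i2,
     would be a combination of vanishing determinants. *)
  have "\<exists>j1<n. \<exists>j2<n. a j1 * b j2 \<noteq> a j2 * b j1"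
  proof (rule ccontr)
    assume no: "\<not> ?thesis"
    have "s ^ i1 * s ^ i2 = (\<Sum>j<n. c i1 j * a j) * (\<Sum>j<n. c i2 j * b j) - (\<Sum>j<n. c i1 j * b j) * (\<Sum>j<n. c i2 j * a j)"
      using sums V1 V2 by simp
    also have "\<dots> = (\<Sum>j<n. \<Sum>k<n. c i1 j * c i2 k * (a j * b k - a k * b j))"
      unfolding sum_product sum_subtractf[symmetric] by (intro sum.cong refl) (simp_all add: algebra_simps)
    also have "\<dots> = 0" using no by (intro sum.neutral) auto
    finally show False using s0 by simp
  qed
  then obtain j1 j2 where j: "j1 < n" "j2 < n" "a j1 * b j2 \<noteq> a j2 * b j1" by blast
  (* p1 q2 + p2 q1 as a polynomial in t *)
  let ?D = "[:2 * (a j1 * a j2), 3 * (a j1 * b j2 + a j2 * b j1), 4 * (b j1 * b j2):]"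
  let ?T = "insert ?D (insert [:0, 1:] ((\<lambda>j. [:a j, b j:]) ` {..<n} \<union> (\<lambda>j. [:a j, 2 * b j:]) ` {..<n}))"
  have "?D \<noteq> 0" using j(3) by (auto simp: add_eq_0_iff)
  moreover have "[:a j, b j:] \<noteq> 0 \<and> [:a j, 2 * b j:] \<noteq> 0" if "j < n" for j using ab[OF that] by simp
  ultimately have "0 \<notin> ?T" by (auto dest: sym)
  then obtain t where t: "\<And>P. P \<in> ?T \<Longrightarrow> poly P t \<noteq> 0" using exists_nonroot[of ?T] by auto
  define p where "p = (\<lambda>v. if v \<in> V1 then s ^ v else t * s ^ v)"
  define q where "q = (\<lambda>v. if v \<in> V1 then s ^ v else 2 * t * s ^ v)"
  have P: "(\<Sum>v<n. u j v * p v) = a j + t * b j" for j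
    unfolding a_def b_def p_def sum_distrib_left sum.distrib[symmetric] by (intro sum.cong) auto
  have Q: "(\<Sum>v<n. u j v * q v) = a j + 2 * t * b j" for j
    unfolding a_def b_def q_def sum_distrib_left sum.distrib[symmetric] by (intro sum.cong) auto
  show thesis
  proof
    show "p v * q w = p w * q v" if "v \<in> V1 \<longleftrightarrow> w \<in> V1" for v w
      using that by (auto simp: p_def q_def)
    show "(\<Sum>v<n. u j v * p v) * (\<Sum>v<n. u j v * q v) \<noteq> 0" if "j < n" for j
      using t[of "[:a j, b j:]"] t[of "[:a j, 2 * b j:]"] that unfolding P Q by (auto simp: ac_simps)
    show "(\<Sum>v<n. u j1 v * p v) * (\<Sum>v<n. u j2 v * q v) \<noteq> (\<Sum>v<n. u j2 v * p v) * (\<Sum>v<n. u j1 v * q v)"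
    proof
      assume "(\<Sum>v<n. u j1 v * p v) * (\<Sum>v<n. u j2 v * q v) = (\<Sum>v<n. u j2 v * p v) * (\<Sum>v<n. u j1 v * q v)"
      then have "t * (a j1 * b j2 - a j2 * b j1) = 0" unfolding P Q by (simp add: algebra_simps)
      then show False using j(3) t[of "[:0, 1:]"] by simp
    qed
    have "(\<Sum>v<n. u j1 v * p v) * (\<Sum>v<n. u j2 v * q v) + (\<Sum>v<n. u j2 v * p v) * (\<Sum>v<n. u j1 v * q v) = poly ?D t"
      unfolding P Q by (simp add: algebra_simps)
    then show "(\<Sum>v<n. u j1 v * p v) * (\<Sum>v<n. u j2 v * q v) + (\<Sum>v<n. u j2 v * p v) * (\<Sum>v<n. u j1 v * q v) \<noteq> 0"
      using t[of ?D] by simp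
  qed (use j in auto)
qed

section \<open>Homomorphisms out of a presented group\<close>

primrec word_eval :: "('h, 'm) monoid_scheme \<Rightarrow> ('a \<Rightarrow> 'h) \<Rightarrow> 'a word \<Rightarrow> 'h" where
  "word_eval H r [] = \<one>\<^bsub>H\<^esub>"
| "word_eval H r (x # w) = (if snd x then r (fst x) else inv\<^bsub>H\<^esub> (r (fst x))) \<otimes>\<^bsub>H\<^esub> word_eval H r w"

lemma presented_group_carrier: "A \<in> carrier (presented_group S R) \<longleftrightarrow> (\<exists>w\<in>words S. A = word_rel S R `` {w})"
  by (auto simp: presented_group_def quotient_def)

lemma presented_group_lift:
  fixes H :: "('h, 'm) monoid_scheme"
  assumes "Group.group H" and r: "\<And>s. s \<in> S \<Longrightarrow> r s \<in> carrier H"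
    and rel: "\<And>w. w \<in> R \<Longrightarrow> w \<in> words S \<Longrightarrow> word_eval H r w = \<one>\<^bsub>H\<^esub>"
  obtains f where "f \<in> hom (presented_group S R) H"
    and "\<And>s. s \<in> S \<Longrightarrow> f (word_rel S R `` {[(s, True)]}) = r s"
proof -
  interpret H: Group.group H by fact
  let ?e = "word_eval H r"
  have closed: "?e w \<in> carrier H" if "w \<in> words S" for w
    using that by (induction w) (auto simp: r)
  have app: "?e (v @ w) = ?e v \<otimes>\<^bsub>H\<^esub> ?e w" if "v \<in> words S" "w \<in> words S" for v w
    using that by (induction v) (auto simp: r closed H.m_assoc)
  have inv: "?e v = ?e w" if "(v, w) \<in> word_rel S R" for v w
    using that
  proof induction
    case (cancel u v x)
    have "?e [x, inv_letter x] = \<one>\<^bsub>H\<^esub>" using cancel by (auto simp: inv_letter_def r)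
    moreover have "[x, inv_letter x] \<in> words S" using cancel by (auto simp: inv_letter_def)
    ultimately show ?case using cancel by (simp add: app closed del: append_Cons word_eval.simps(2))
  next
    case (relator u v w)
    then show ?case by (simp add: app closed rel)
  qed auto
  define f where "f = (\<lambda>A. ?e (SOME w. w \<in> A))"
  have f: "f (word_rel S R `` {w}) = ?e w" if "w \<in> words S" for w
  proof -
    have "w \<in> word_rel S R `` {w}" using that by (simp add: word_rel.refl)
    then have "(SOME v. v \<in> word_rel S R `` {w}) \<in> word_rel S R `` {w}" by (rule someI)
    then show ?thesis unfolding f_def using inv by (metis Image_singleton_iff)
  qed
  show thesis
  proof
    show "f \<in> hom (presented_group S R) H"
    proof (rule homI)
      show "f A \<in> carrier H" if "A \<in> carrier (presented_group S R)" for A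
        using that closed by (auto simp: presented_group_carrier f)
      fix A B assume "A \<in> carrier (presented_group S R)" "B \<in> carrier (presented_group S R)"
      then obtain v w where "v \<in> words S" "w \<in> words S" "A = word_rel S R `` {v}" "B = word_rel S R `` {w}"
        unfolding presented_group_carrier by blast
      then show "f (A \<otimes>\<^bsub>presented_group S R\<^esub> B) = f A \<otimes>\<^bsub>H\<^esub> f B"
        by (simp only: presented_group_mult f app words_append)
    qed
    show "f (word_rel S R `` {[(s, True)]}) = r s" if "s \<in> S" for s
      using that by (simp add: f r del: Image_singleton_iff)
  qed
qed

lemma generate_presented_group:
  "generate (presented_group S R) ((\<lambda>s. word_rel S R `` {[(s, True)]}) ` S) = carrier (presented_group S R)"
  (is "generate ?G (?g ` S) = _")
proof
  interpret Group.group ?G by (rule group_presented_group)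
  let ?c = "\<lambda>w. word_rel S R `` {w}"
  have one: "\<one>\<^bsub>?G\<^esub> = ?c []" by (simp add: presented_group_def)
  have car: "?c w \<in> carrier ?G" if "w \<in> words S" for w using that unfolding presented_group_carrier by blast
  show "generate ?G (?g ` S) \<subseteq> carrier ?G" by (rule generate_incl) (auto intro!: car)
  have letter: "?c [x] \<in> generate ?G (?g ` S)" if x: "x \<in> S \<times> UNIV" for x
  proof (cases x)
    case (Pair s b)
    show ?thesis
    proof (cases b)
      case True
      then show ?thesis using x Pair by (auto intro!: generate.incl)
    next
      case False
      have "([(s, False), (s, True)], []) \<in> word_rel S R"
        using word_rel.cancel[of "[]" S "[]" "(s, False)" R] x Pair by (simp add: inv_letter_def)
      then have "?c [(s, False)] \<otimes>\<^bsub>?G\<^esub> ?c [(s, True)] = \<one>\<^bsub>?G\<^esub>"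
        using equiv_class_eq[OF equiv_word_rel] x Pair unfolding one by (simp add: presented_group_mult del: Image_singleton_iff)
      then have "inv\<^bsub>?G\<^esub> (?c [(s, True)]) = ?c [(s, False)]"
        using x Pair by (intro inv_equality car) auto
      then show ?thesis using generate.inv[of "?g s" "?g ` S" ?G] x Pair False by auto
    qed
  qed
  have "?c w \<in> generate ?G (?g ` S)" if "w \<in> words S" for w
    using that
  proof (induction w)
    case Nil
    show ?case unfolding one[symmetric] by (rule generate.one)
  next
    case (Cons x w)
    then have "?c (x # w) = ?c [x] \<otimes>\<^bsub>?G\<^esub> ?c w" using presented_group_mult[of "[x]" S w R] by simp
    then show ?case using generate.eng[OF letter Cons.IH, of x] Cons.prems by simp
  qed
  then show "carrier ?G \<subseteq> generate ?G (?g ` S)"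
    by (intro subsetI) (metis presented_group_carrier)
qed

text \<open>
  Invertibility comes for free for constant term one, and \<open>poly_funs_coefficient\<close> needs this normalization.
\<close>

definition unipotent_fps :: "'r::ring_1 fps monoid" where
  "unipotent_fps = \<lparr>carrier = {f. fps_nth f 0 = 1}, monoid.mult = (*), one = 1\<rparr>"

lemma group_unipotent_fps: "Group.group (unipotent_fps :: 'r::ring_1 fps monoid)"
proof (rule groupI)
  fix f :: "'r fps" assume "f \<in> carrier unipotent_fps"
  then have "fps_left_inverse f 1 * f = 1" "fps_nth (fps_left_inverse f 1) 0 = 1"
    by (simp_all add: unipotent_fps_def fps_left_inverse)
  then show "\<exists>g\<in>carrier unipotent_fps. g \<otimes>\<^bsub>unipotent_fps\<^esub> f = \<one>\<^bsub>unipotent_fps\<^esub>"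
    by (intro bexI[of _ "fps_left_inverse f 1"]) (simp_all add: unipotent_fps_def)
qed (auto simp: unipotent_fps_def mult.assoc)

lemma (in group) commutator_eq_one:
  assumes "x \<in> carrier G" "y \<in> carrier G" "x \<otimes> y = y \<otimes> x"
  shows "x \<otimes> (y \<otimes> (inv x \<otimes> (inv y \<otimes> \<one>))) = \<one>"
proof -
  have "x \<otimes> (y \<otimes> (inv x \<otimes> (inv y \<otimes> \<one>))) = (x \<otimes> y) \<otimes> inv (y \<otimes> x)"
    using assms(1,2) by (simp add: m_assoc inv_mult_group)
  then show ?thesis using assms by simp
qed

section \<open>Right-angled Artin groups of disconnected graphs\<close>

text \<open>
  The universal property of the right-angled Artin group: images of the vertices may be chosen freely,
  provided that adjacent vertices get commuting images.
\<close>

lemma raag_lift: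
  fixes H :: "('h, 'm) monoid_scheme"
  assumes H: "Group.group H" and r: "\<And>v. v \<in> pverts \<Gamma> \<Longrightarrow> r v \<in> carrier H"
    and comm: "\<And>v w. (v, w) \<in> parcs \<Gamma> \<Longrightarrow> v \<in> pverts \<Gamma> \<Longrightarrow> w \<in> pverts \<Gamma> \<Longrightarrow> r v \<otimes>\<^bsub>H\<^esub> r w = r w \<otimes>\<^bsub>H\<^esub> r v"
  obtains f where "f \<in> hom (raag \<Gamma>) H"
    and "\<And>v. v \<in> pverts \<Gamma> \<Longrightarrow>
      f (word_rel (pverts \<Gamma>) {commutator_word v w | v w. (v, w) \<in> parcs \<Gamma>} `` {[(v, True)]}) = r v"
proof (rule presented_group_lift[OF H r])
  fix w assume w: "w \<in> {commutator_word v w | v w. (v, w) \<in> parcs \<Gamma>}" "w \<in> words (pverts \<Gamma>)"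
  then obtain x y where xy: "(x, y) \<in> parcs \<Gamma>" "w = commutator_word x y" by blast
  then have "x \<in> pverts \<Gamma>" "y \<in> pverts \<Gamma>" using w(2) by (auto simp: commutator_word_def)
  then show "word_eval H r w = \<one>\<^bsub>H\<^esub>"
    using group.commutator_eq_one[OF H r r comm[OF xy(1)]] by (simp add: xy(2) commutator_word_def)
qed (use that in \<open>auto simp: raag_def\<close>)

lemma disconnected_split:
  assumes "pair_graph \<Gamma>" "pverts \<Gamma> \<noteq> {}" "\<not> Digraph_Component.connected (with_proj \<Gamma>)"
  obtains C a b where "a \<in> pverts \<Gamma>" "a \<in> C" "b \<in> pverts \<Gamma>" "b \<notin> C"
    and "\<And>x y. (x, y) \<in> parcs \<Gamma> \<Longrightarrow> x \<in> C \<longleftrightarrow> y \<in> C"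
proof -
  interpret pair_graph \<Gamma> by fact
  let ?S = "mk_symmetric (with_proj \<Gamma>)"
  interpret S: pair_wf_digraph ?S by (rule wellformed_mk_symmetric)
  obtain a b where ab: "a \<in> pverts \<Gamma>" "b \<in> pverts \<Gamma>" "\<not> a \<rightarrow>\<^sup>*\<^bsub>with_proj ?S\<^esub> b"
    using assms(2,3) unfolding Digraph_Component.connected_def strongly_connected_def by auto
  have arc: "(x, y) \<in> parcs ?S" "(y, x) \<in> parcs ?S" if "(x, y) \<in> parcs \<Gamma>" for x y
    using that by (auto simp: mk_symmetric_def intro!: bexI[of _ "(x, y)"])
  show thesis
  proof (rule that[of a "{x. a \<rightarrow>\<^sup>*\<^bsub>with_proj ?S\<^esub> x}" b])
    show "a \<in> {x. a \<rightarrow>\<^sup>*\<^bsub>with_proj ?S\<^esub> x}" using ab(1) by simp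
    show "x \<in> {x. a \<rightarrow>\<^sup>*\<^bsub>with_proj ?S\<^esub> x} \<longleftrightarrow> y \<in> {x. a \<rightarrow>\<^sup>*\<^bsub>with_proj ?S\<^esub> x}" if "(x, y) \<in> parcs \<Gamma>" for x y
      using S.reachable_adj_trans[OF _ arc(1)[OF that], of a] S.reachable_adj_trans[OF _ arc(2)[OF that], of a]
      by (auto simp only: mem_Collect_eq)
  qed (use ab in auto)
qed

lemma prod_list_doubled: "(\<Prod>j\<leftarrow>concat (map (\<lambda>j. [j, j]) os). l j) = (\<Prod>j\<leftarrow>os. l j :: complex)\<^sup>2"
  by (induction os) (auto simp: power2_eq_square)

theorem theorem4p1p4:
  fixes \<Gamma> :: "'a pair_pre_digraph"
  assumes "pair_graph \<Gamma>"
    and "pverts \<Gamma> \<noteq> {}"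
    and "\<not> Digraph_Component.connected (with_proj \<Gamma>)"
  shows "R_infinity (raag \<Gamma>)"
proof -
  let ?V = "pverts \<Gamma>" and ?G = "raag \<Gamma>"
  define cls where "cls = (\<lambda>v. word_rel ?V {commutator_word v w | v w. (v, w) \<in> parcs \<Gamma>} `` {[(v, True)]})"
  obtain C a b where C: "a \<in> ?V" "a \<in> C" "b \<in> ?V" "b \<notin> C"
    and arcs: "\<And>x y. (x, y) \<in> parcs \<Gamma> \<Longrightarrow> x \<in> C \<longleftrightarrow> y \<in> C"
    using disconnected_split[OF assms] by metis
  have fin: "finite ?V" using assms(1) by (simp add: pair_graph_def pair_digraph_def pair_fin_digraph_def pair_fin_digraph_axioms_def)
  define n where "n = card ?V"
  obtain h where h: "bij_betw h {..<n} ?V"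
    using ex_bij_betw_nat_finite[OF fin] by (auto simp: n_def atLeast0LessThan)
  define idx where "idx = inv_into {..<n} h"
  have hV: "h i \<in> ?V" if "i < n" for i using h that by (auto simp: bij_betw_def)
  have idx_h: "idx (h i) = i" if "i < n" for i using h that unfolding idx_def by (simp add: bij_betw_def)
  have idx_V: "idx v < n" "h (idx v) = v" if "v \<in> ?V" for v
    using h that unfolding idx_def by (metis bij_betw_def inv_into_into lessThan_iff, metis bij_betw_inv_into_right)
  have "\<exists>f. f \<in> hom ?G integer_group \<and> (\<forall>v\<in>?V. f (cls v) = (if v = h i then 1 else 0))" for i
    by (rule raag_lift[OF group_integer_group, of \<Gamma> "\<lambda>v. if v = h i then 1 else 0"])
      (auto simp: cls_def add.commute integer_group_def)
  then obtain expo where expo: "\<And>i. expo i \<in> hom ?G integer_group"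
    "\<And>i v. v \<in> ?V \<Longrightarrow> expo i (cls v) = (if v = h i then 1 else 0)" by metis
  define gen where "gen = (\<lambda>i. cls (h i))"
  have img: "gen ` {..<n} = cls ` ?V" using h by (auto simp: gen_def bij_betw_def image_image[symmetric])
  interpret marked_group ?G n gen expo
  proof (intro marked_group.intro group_raag marked_group_axioms.intro)
    show "generate ?G (gen ` {..<n}) = carrier ?G"
      unfolding img cls_def raag_def by (rule generate_presented_group)
    show "gen i \<in> carrier ?G" if "i < n" for i
      using hV[OF that] unfolding gen_def cls_def raag_def presented_group_carrier by (intro bexI[of _ "[(h i, True)]"]) auto
    show "expo i (x \<otimes>\<^bsub>?G\<^esub> y) = expo i x + expo i y" if "x \<in> carrier ?G" "y \<in> carrier ?G" for i x y
      using hom_mult[OF expo(1) that] by (simp add: integer_group_def)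
    show "expo i (gen j) = (if i = j then 1 else 0)" if "i < n" "j < n" for i j
      using expo(2)[OF hV[OF that(2)], of i] idx_h that unfolding gen_def by metis
  qed
  show ?thesis unfolding R_infinity_def
  proof
    fix \<phi> assume \<phi>: "\<phi> \<in> iso ?G ?G"
    then have \<phi>h: "\<phi> \<in> hom ?G ?G" by (simp add: iso_def)
    obtain l u c where ev: "\<And>j. j < n \<Longrightarrow> \<exists>K. (shifted_op n (action_matrix \<phi>) (l j) ^^ K) (u j) = (\<lambda>_. 0)"
      and dual: "\<And>i k. i < n \<Longrightarrow> k < n \<Longrightarrow> (\<Sum>j<n. c i j * u j k) = (if k = i then 1 else 0)"
      and nz: "\<And>j. j < n \<Longrightarrow> \<exists>k<n. u j k \<noteq> 0"
      and det: "(\<Prod>j<n. l j) = Determinant.det (mat n n (\<lambda>(i,j). action_matrix \<phi> i j))"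
      using generalized_eigenbasis[of n "action_matrix \<phi>"] by blast
    have C': "idx a < n" "idx a \<in> {i. h i \<in> C}" "idx b < n" "idx b \<notin> {i. h i \<in> C}"
      using C idx_V by auto
    obtain p q j1 j2 where pq: "\<And>v w. (v \<in> {i. h i \<in> C} \<longleftrightarrow> w \<in> {i. h i \<in> C}) \<Longrightarrow> p v * q w = p w * q v"
      and PQ: "\<And>j. j < n \<Longrightarrow> (\<Sum>v<n. u j v * p v) * (\<Sum>v<n. u j v * q v) \<noteq> 0"
      and j: "j1 < n" "j2 < n"
      and ind: "(\<Sum>v<n. u j1 v * p v) * (\<Sum>v<n. u j2 v * q v) \<noteq> (\<Sum>v<n. u j2 v * p v) * (\<Sum>v<n. u j1 v * q v)"
        "(\<Sum>v<n. u j1 v * p v) * (\<Sum>v<n. u j2 v * q v) + (\<Sum>v<n. u j2 v * p v) * (\<Sum>v<n. u j1 v * q v) \<noteq> 0"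
      by (rule generic_weights[OF dual nz C'], assumption+) blast
    define z where "z = (\<lambda>i. antidiag (p i) (q i))"
    obtain r where r: "r \<in> hom ?G (unipotent_fps :: mat2 fps monoid)"
      and r_cls: "\<And>v. v \<in> ?V \<Longrightarrow> r (cls v) = 1 + fps_const (z (idx v)) * fps_X"
    proof (rule raag_lift[OF group_unipotent_fps, of \<Gamma> "\<lambda>v. 1 + fps_const (z (idx v)) * fps_X"])
      fix v w assume vw: "(v, w) \<in> parcs \<Gamma>" "v \<in> ?V" "w \<in> ?V"
      have "p (idx v) * q (idx w) = p (idx w) * q (idx v)"
        using arcs[OF vw(1)] idx_V vw by (intro pq) auto
      then have "z (idx v) * z (idx w) = z (idx w) * z (idx v)"
        by (simp add: z_def antidiag_def times_mat2_def mult.commute)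
      then have "(fps_const (z (idx v)) * fps_X) * (fps_const (z (idx w)) * fps_X) =
          (fps_const (z (idx w)) * fps_X) * (fps_const (z (idx v)) * fps_X)"
        using fps_const_X_power_mult[of "z (idx v)" 1 "z (idx w)" 1] fps_const_X_power_mult[of "z (idx w)" 1 "z (idx v)" 1]
        by simp
      then show "(1 + fps_const (z (idx v)) * fps_X) \<otimes>\<^bsub>unipotent_fps\<^esub> (1 + fps_const (z (idx w)) * fps_X) =
          (1 + fps_const (z (idx w)) * fps_X) \<otimes>\<^bsub>unipotent_fps\<^esub> (1 + fps_const (z (idx v)) * fps_X)"
        by (simp add: unipotent_fps_def distrib_left distrib_right add.assoc add.left_commute)
    qed (auto simp: unipotent_fps_def cls_def)
    have r_mult: "r (x \<otimes>\<^bsub>?G\<^esub> y) = r x * r y" if "x \<in> carrier ?G" "y \<in> carrier ?G" for x y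
      using hom_mult[OF r that] by (simp add: unipotent_fps_def)
    have r_unip: "fps_nth (r x) 0 = 1" if "x \<in> carrier ?G" for x
      using hom_in_carrier[OF r that] by (simp add: unipotent_fps_def)
    have r_one: "r \<one>\<^bsub>?G\<^esub> = 1"
      using hom_one[OF r group_raag group_unipotent_fps] by (simp add: unipotent_fps_def)
    have r_gen: "r (gen v) = 1 + fps_const (z v) * fps_X" if "v < n" for v
      using r_cls[OF hV[OF that]] idx_h[OF that] by (simp add: gen_def)
    (* Every index occurs exactly twice in js, so that the eigenvalues multiply to a square. *)
    define os where "os = sorted_list_of_set ({..<n} - {j1, j2})"
    define js where "js = concat (map (\<lambda>j. [j, j]) os) @ [j1, j2, j1, j2]"
    have os: "distinct os" "set os = {..<n} - {j1, j2}" by (simp_all add: os_def)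
    have js: "set js \<subseteq> {..<n}" using os j by (auto simp: js_def)
    have ne: "j1 \<noteq> j2" using ind(1) by auto
    have prod: "(\<Prod>j\<leftarrow>js. l j) = 1"
    proof -
      have "{..<n} = insert j1 (insert j2 (set os))" using j os by auto
      then have "(\<Prod>j<n. l j) = prod l (insert j1 (insert j2 (set os)))" by simp
      also have "\<dots> = l j1 * (l j2 * prod l (set os))"
      proof -
        have "j1 \<notin> set os" "j2 \<notin> set os" using os(2) by auto
        with ne show ?thesis by simp
      qed
      also have "prod l (set os) = (\<Prod>j\<leftarrow>os. l j)" by (rule prod.distinct_set_conv_list[OF os(1)])
      finally have "(\<Prod>j<n. l j) = l j1 * (l j2 * (\<Prod>j\<leftarrow>os. l j))" .
      then have "(\<Prod>j\<leftarrow>js. l j) = (\<Prod>j<n. l j)\<^sup>2"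
        unfolding js_def map_append prod_list.append prod_list_doubled by (simp add: power2_eq_square ac_simps)
      also have "\<dots> = 1" unfolding det by (rule det_action_matrix[OF \<phi>])
      finally show ?thesis .
    qed
    define t where "t = (\<lambda>s::mat2 fps. m11 (fps_nth s (length js)))"
    define f where "f = (\<lambda>x. if x \<in> carrier ?G then t (r x) else 0)"
    have f: "f \<in> poly_funs (Suc (length js))"
    proof -
      have "(\<lambda>x. if x \<in> carrier ?G then m11 (fps_nth (r x * 1) (length js)) else 0) \<in> poly_funs (Suc (length js))"
        by (rule poly_funs_coefficient[OF r_mult r_unip]) auto
      then show ?thesis unfolding f_def t_def mult_1_right .
    qed
    let ?Z = "\<lambda>u. fps_const (\<Sum>v<n. scalar_mat (u v) * z v) * fps_X"
    have "lie_functional (map u js) f = t (lie_bracket ?Z (map u js))"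
      unfolding f_def
      by (rule lie_functional_representation[OF r_mult r_one r_gen])
        (auto simp: js_def t_def plus_mat2_def times_mat2_def scalar_mat_def)
    also have "lie_bracket ?Z (map u js) =
        fps_const (lie_bracket (\<lambda>j. antidiag (\<Sum>v<n. u j v * p v) (\<Sum>v<n. u j v * q v)) js) * fps_X ^ length js"
      unfolding lie_bracket_map comp_def z_def antidiag_sum by (rule lie_bracket_fps_X) (simp add: js_def)
    also have "t \<dots> = m11 (lie_bracket (\<lambda>j. antidiag (\<Sum>v<n. u j v * p v) (\<Sum>v<n. u j v * q v)) js)"
      by (simp add: t_def fps_X_power_iff)
    also have "\<dots> \<noteq> 0"
      unfolding js_def by (rule lie_bracket_antidiag_nonzero) (use ind PQ os in auto)
    finally show "reidemeister_number ?G \<phi> = \<infinity>"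
      using infinite_reidemeister_if_lie_functional[of \<phi> js l u f, OF \<phi>h _ prod f] ev js by blast
  qed
qed

end
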